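(* Let $K$ be a (finite) triangulation of the $2$-simplex $\Delta^2$ with vertices $v_1,v_2,v_3$, and let $\sigma$ be any facet of $K$. Then there exists a Sperner labelling of $K$ in which $\sigma$ is the unique rainbow facet.
   Context: A triangulation of the $d$-simplex $\Delta^d$ (with vertices $v_1,\dots,v_{d+1}$) is a finite geometric simplicial complex $K$ whose union of simplices is $\Delta^d$ (a subdivision of $\Delta^d$); the vertices $v_1,\dots,v_{d+1}$ are vertices of $K$. The facets of $K$ are its $d$-dimensional simplices. A Sperner labelling of $K$ is a map $\lambda: V(K)\to\{1,\dots,d+1\}$ such that $\lambda(v_i)=i$ for each $i$, and every vertex of $K$ lying in a face of $\Delta^d$ has the same label as one of the vertices of that face. A simplex is rainbow if its vertices receive pairwise distinct labels. *)

theory Defs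
  imports "HOL-Analysis.Analysis"
begin

text \<open>
  A geometric simplicial complex is a \<^const>\<open>simplicial_complex\<close> of the library: a finite set of
  simplices (given as point sets) closed under faces, any two of which meet in a common face.
  The empty simplex counts as a face, of dimension -1. The library's \<^const>\<open>triangulation\<close> is
  weaker, since it is not required to be closed under faces.
\<close>

definition triangulates :: "'a::euclidean_space set set \<Rightarrow> 'a set \<Rightarrow> bool" where
  "triangulates K S \<longleftrightarrow> simplicial_complex K \<and> \<Union>K = S"

definition simplex_vertices :: "'a::euclidean_space set \<Rightarrow> 'a set" where
  "simplex_vertices S = {x. x extreme_point_of S}"

definition complex_vertices :: "'a::euclidean_space set set \<Rightarrow> 'a set" where
  "complex_vertices K = {x. {x} \<in> K}"

text \<open>
  The facets of a triangulation of a \<open>d\<close>-simplex are its \<open>d\<close>-dimensional simplices; this is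
  unrelated to the library's \<^const>\<open>facet_of\<close>, which refers to faces of codimension one.
\<close>

definition complex_facets :: "nat \<Rightarrow> 'a::euclidean_space set set \<Rightarrow> 'a set set" where
  "complex_facets d K = {S \<in> K. int d simplex S}"

text \<open>
  \<open>v 1, \<dots>, v (d + 1)\<close> are the vertices of a (nondegenerate) \<open>d\<close>-simplex. Affine independence of the
  image alone would allow repetitions, hence the injectivity.
\<close>

definition spans_simplex :: "nat \<Rightarrow> (nat \<Rightarrow> 'a::euclidean_space) \<Rightarrow> bool" where
  "spans_simplex d v \<longleftrightarrow> inj_on v {1..d+1} \<and> \<not> affine_dependent (v ` {1..d+1})"

definition std_simplex :: "nat \<Rightarrow> (nat \<Rightarrow> 'a::euclidean_space) \<Rightarrow> 'a set" where
  "std_simplex d v = convex hull (v ` {1..d+1})"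

text \<open>Only the values of \<open>l\<close> on the vertices of \<open>K\<close> matter.\<close>

definition sperner_labelling ::
    "nat \<Rightarrow> (nat \<Rightarrow> 'a::euclidean_space) \<Rightarrow> 'a set set \<Rightarrow> ('a \<Rightarrow> nat) \<Rightarrow> bool" where
  "sperner_labelling d v K l \<longleftrightarrow>
     l \<in> complex_vertices K \<rightarrow> {1..d+1} \<and>
     (\<forall>i\<in>{1..d+1}. l (v i) = i) \<and>
     (\<forall>F. F face_of std_simplex d v \<longrightarrow>
        (\<forall>x \<in> complex_vertices K \<inter> F. \<exists>w \<in> simplex_vertices F. l x = l w))"

definition rainbow :: "('a::euclidean_space \<Rightarrow> nat) \<Rightarrow> 'a set \<Rightarrow> bool" where
  "rainbow l S \<longleftrightarrow> inj_on l (simplex_vertices S)"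

lemma simplex_vertices_std_simplex:
  assumes "spans_simplex d v"
  shows "simplex_vertices (std_simplex d v) = v ` {1..d+1}"
  using assms extreme_point_of_convex_hull_affine_independent
  unfolding simplex_vertices_def std_simplex_def spans_simplex_def by blast

text \<open>That the \<open>v i\<close> are vertices of \<open>K\<close> need not be assumed separately.\<close>

lemma triangulates_vertices:
  assumes "spans_simplex d v" "triangulates K (std_simplex d v)" "i \<in> {1..d+1}"
  shows "v i \<in> complex_vertices K"
proof -
  have K: "simplicial_complex K" and U: "\<Union>K = std_simplex d v"
    using assms(2) by (auto simp: triangulates_def)
  have ext: "v i extreme_point_of std_simplex d v"
    using simplex_vertices_std_simplex[OF assms(1)] assms(3)
    unfolding simplex_vertices_def by blast
  then obtain S where S: "S \<in> K" "v i \<in> S"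
    using U unfolding extreme_point_of_def by blast
  have "v i extreme_point_of S"
    using ext S U unfolding extreme_point_of_def by blast
  then have "{v i} face_of S"
    by (simp add: face_of_singleton)
  with K S show ?thesis
    unfolding simplicial_complex_def complex_vertices_def by blast
qed

end

theory Submission
  imports Defs "HOL-Complex_Analysis.Complex_Analysis"
begin

text \<open>
  Fix a point \<open>p\<close> in the interior of \<open>\<sigma>\<close>. A labelling whose only rainbow facet is \<open>\<sigma>\<close> lifts to an
  integer function on the vertices of the universal cover of the triangle punctured at \<open>p\<close> that
  changes by at most 1 along every edge and increases by 3 with each turn around \<open>p\<close>; conversely the
  residues modulo 3 of such a function form a labelling of this kind. By the duality between
  potentials and cycles of negative weight, the function exists iff every closed walk of winding
  number \<open>n\<close> about \<open>p\<close> has length at least \<open>3 n\<close>. For a walk without repeated vertices this holds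
  because a simple closed curve has winding number at most 1, and any other closed walk splits into
  shorter ones at a repeated vertex.

  The boundary conditions are enforced by admitting as edges all pairs of vertices on a common side of
  the big triangle. These chords overlap; but two chords on the same side used by a closed walk can
  exchange their end points, which again splits the walk, so that a single chord per side remains,
  and that one can be pushed out of the triangle.
\<close>

subsection \<open>Walks and potentials\<close>

definition steps :: "'a list \<Rightarrow> ('a \<times> 'a) set" where
  "steps xs = set (zip xs (tl xs))"

fun walk_weight :: "('a \<Rightarrow> 'a \<Rightarrow> 'b::comm_monoid_add) \<Rightarrow> 'a list \<Rightarrow> 'b" where
  "walk_weight d (x # y # zs) = d x y + walk_weight d (y # zs)"
| "walk_weight d _ = 0"

lemma steps_simps [simp]:
  "steps [] = {}" "steps [x] = {}" "steps (x # y # zs) = insert (x, y) (steps (y # zs))"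
  by (simp_all add: steps_def)

lemma steps_subset: "steps xs \<subseteq> set xs \<times> set xs"
  by (induction xs rule: induct_list012) auto

lemma steps_split: "steps (xs @ y # ys) = steps (xs @ [y]) \<union> steps (y # ys)"
  by (induction xs rule: induct_list012) auto

lemma walk_weight_split:
  "walk_weight d (xs @ y # ys) = walk_weight d (xs @ [y]) + walk_weight d (y # ys)"
  by (induction xs rule: induct_list012) (auto simp: add.assoc)

lemma steps_append:
  "xs \<noteq> [] \<Longrightarrow> steps (xs @ y # ys) = steps xs \<union> insert (last xs, y) (steps (y # ys))"
  by (induction xs rule: induct_list012) auto

lemma walk_weight_append:
  "xs \<noteq> [] \<Longrightarrow> walk_weight d (xs @ y # ys) = walk_weight d xs + (d (last xs) y + walk_weight d (y # ys))"
  by (induction xs rule: induct_list012) (auto simp: add.assoc)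

lemma steps_nth:
  "steps xs = {(xs ! i, xs ! Suc i) | i. Suc i < length xs}"
  unfolding steps_def set_zip by (auto simp: nth_tl)

text \<open>The differences of \<open>h\<close> telescope. With \<open>h\<close> the normalised
  argument and \<open>c\<close> the turn offset, this turns a sum of angles along a closed walk into
  a sum of integers.\<close>

lemma walk_weight_diff:
  fixes h :: "'a \<Rightarrow> 'b::ab_group_add"
  assumes "\<And>x y. (x, y) \<in> steps xs \<Longrightarrow> d x y = h y - h x + c x y" "xs \<noteq> []"
  shows "walk_weight d xs = h (last xs) - h (hd xs) + walk_weight c xs"
  using assms
proof (induction xs rule: induct_list012)
  case (3 x y zs)
  have "d x y = h y - h x + c x y" by (rule "3.prems"(1)) simp
  moreover have "walk_weight d (y # zs) = h (last (y # zs)) - h (hd (y # zs)) + walk_weight c (y # zs)"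
    by (rule "3.IH"(2)) (use "3.prems" in auto)
  ultimately show ?case by simp
qed auto

text \<open>Shortest distances, as in the Bellman-Ford argument: appending the edge
  \<open>(x, y)\<close> to a lightest walk to \<open>x\<close> gives the inequality. Walks may start
  anywhere, and the one-vertex walk of weight 0 takes the place of a source.\<close>

lemma potential_exists:
  fixes d :: "'a \<Rightarrow> 'a \<Rightarrow> int"
  assumes "finite V" "E \<subseteq> V \<times> V"
    and nonneg: "\<And>xs. xs \<noteq> [] \<Longrightarrow> steps xs \<subseteq> E \<Longrightarrow> hd xs = last xs \<Longrightarrow> 0 \<le> walk_weight d xs"
  shows "\<exists>f. \<forall>(x, y) \<in> E. f y \<le> f x + d x y"
proof -
  \<comment> \<open>Walks without repetition form a finite set, so that a minimum exists; by
    \<open>shorten\<close>, cutting out closed pieces reduces any walk to one of these without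
    raising its weight.\<close>
  define W where "W y = {xs. distinct xs \<and> set xs \<subseteq> V \<and> xs \<noteq> [] \<and> last xs = y \<and> steps xs \<subseteq> E}" for y
  have finW: "finite (W y)" for y
    unfolding W_def by (rule finite_subset[OF _ finite_subset_distinct[OF assms(1)]]) blast
  have shorten: "\<exists>ys \<in> W (last xs). walk_weight d ys \<le> walk_weight d xs"
    if "xs \<noteq> []" "set xs \<subseteq> V" "steps xs \<subseteq> E" for xs
    using that
  proof (induction "length xs" arbitrary: xs rule: less_induct)
    case less
    show ?case
    proof (cases "distinct xs")
      case True
      then show ?thesis using less.prems unfolding W_def by blast
    next
      case False
      then obtain as b bs cs where xs: "xs = as @ [b] @ bs @ [b] @ cs"
        using not_distinct_decomp by blast
      have S: "steps xs = steps (as @ [b]) \<union> steps (b # bs @ [b]) \<union> steps (b # cs)"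
        using steps_split[of as b "bs @ b # cs"] steps_split[of "b # bs" b cs]
        unfolding xs by simp (blast)
      have w: "walk_weight d xs = walk_weight d (as @ b # cs) + walk_weight d (b # bs @ [b])"
        using walk_weight_split[of d as b "bs @ b # cs"] walk_weight_split[of d "b # bs" b cs]
          walk_weight_split[of d as b "cs"]
        unfolding xs by simp
      have "0 \<le> walk_weight d (b # bs @ [b])"
        using nonneg[of "b # bs @ [b]"] less.prems S by auto
      moreover have "\<exists>ys \<in> W (last (as @ b # cs)). walk_weight d ys \<le> walk_weight d (as @ b # cs)"
        using less.prems S steps_split[of as b cs] by (intro less.hyps) (auto simp: xs)
      moreover have "last (as @ b # cs) = last xs" by (simp add: xs)
      ultimately obtain zs where "zs \<in> W (last xs)" "walk_weight d zs \<le> walk_weight d (as @ b # cs)"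
        "0 \<le> walk_weight d (b # bs @ [b])" by metis
      then show ?thesis
        using w by (intro bexI[of _ zs]) auto
    qed
  qed
  define f where "f y = Min (walk_weight d ` W y)" for y
  have "f y \<le> f x + d x y" if "(x, y) \<in> E" for x y
  proof -
    have "x \<in> V" "y \<in> V" using that assms(2) by auto
    then have "[x] \<in> W x" unfolding W_def by auto
    then have "f x \<in> walk_weight d ` W x"
      unfolding f_def using finW by (intro Min_in) auto
    then obtain xs where xs: "xs \<in> W x" "f x = walk_weight d xs" by blast
    then have "xs = butlast xs @ [x]"
      unfolding W_def using append_butlast_last_id[of xs] by auto
    then obtain as where as: "xs = as @ [x]" by blast
    have "set as \<subseteq> V" "steps (as @ [x]) \<subseteq> E"
      using xs(1) unfolding as W_def by auto
    then have "set (as @ [x, y]) \<subseteq> V" "steps (as @ [x, y]) \<subseteq> E"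
      using steps_split[of as x "[y]"] \<open>x \<in> V\<close> \<open>y \<in> V\<close> that by auto
    then obtain ys where ys: "ys \<in> W y" "walk_weight d ys \<le> walk_weight d (as @ [x, y])"
      using shorten[of "as @ [x, y]"] by auto
    have "walk_weight d (as @ [x, y]) = f x + d x y"
      using walk_weight_split[of d as x "[y]"] unfolding xs(2) as by simp
    moreover have "f y \<le> walk_weight d ys"
      unfolding f_def using finW ys(1) by (intro Min_le) auto
    ultimately show ?thesis using ys(2) by simp
  qed
  then show ?thesis by blast
qed

text \<open>Induction on the length: a repeated vertex, or two steps inside the same
  \<open>S i\<close>, splits the walk into two shorter closed walks of the same total weight. A walk
  with neither is covered by \<open>simple\<close>.\<close>

lemma closed_walk_weight_nonneg:
  fixes d :: "'a \<Rightarrow> 'a \<Rightarrow> int" and S :: "'i \<Rightarrow> 'a set"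
  assumes side: "\<And>i. S i \<times> S i \<subseteq> E"
    and exchange: "\<And>i u w u' w'. \<lbrakk>u \<in> S i; w \<in> S i; u' \<in> S i; w' \<in> S i\<rbrakk>
        \<Longrightarrow> d u w + d u' w' = d u w' + d u' w"
    and simple: "\<And>xs. \<lbrakk>xs \<noteq> []; distinct xs; steps (xs @ [hd xs]) \<subseteq> E;
        \<And>i e e'. \<lbrakk>e \<in> steps (xs @ [hd xs]); e' \<in> steps (xs @ [hd xs]); e \<noteq> e'\<rbrakk>
          \<Longrightarrow> \<not> (e \<in> S i \<times> S i \<and> e' \<in> S i \<times> S i)\<rbrakk>
        \<Longrightarrow> 0 \<le> walk_weight d (xs @ [hd xs])"
  assumes "xs \<noteq> []" "steps xs \<subseteq> E" "hd xs = last xs"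
  shows "0 \<le> walk_weight d xs"
  using assms(4-6)
proof (induction "length xs" arbitrary: xs rule: less_induct)
  case less
  show ?case
  proof (cases "length xs = 1")
    case True
    then obtain x where "xs = [x]" by (auto simp: length_Suc_conv)
    then show ?thesis by simp
  next
    case False
    define ys where "ys = butlast xs"
    have ys: "xs = ys @ [hd ys]" "ys \<noteq> []"
    proof -
      have "length ys > 0"
        using False less.prems(1) unfolding ys_def by (cases xs) auto
      then show ne: "ys \<noteq> []" by auto
      have "xs = ys @ [last xs]"
        unfolding ys_def using less.prems(1) by simp
      moreover have "hd ys = hd xs"
        using ne unfolding ys_def by (metis append_butlast_last_id butlast.simps(1) hd_append2)
      ultimately show "xs = ys @ [hd ys]" using less.prems(3) by simp
    qed
    show ?thesis
    proof (cases "distinct ys")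
      case False
      then obtain as b bs cs where d: "ys = as @ [b] @ bs @ [b] @ cs"
        using not_distinct_decomp by blast
      define h where "h = hd ys"
      have xs: "xs = as @ b # bs @ b # cs @ [h]"
        using ys d h_def by simp
      \<comment> \<open>If \<open>as\<close> is empty, the walk starts at \<open>b\<close> itself.
        This form covers both cases and shows that the walk left after the cut is closed.\<close>
      have h: "h = hd (as @ [b])" unfolding h_def d by (cases as) auto
      have S: "steps xs = steps (as @ [b]) \<union> steps (b # bs @ [b]) \<union> steps (b # cs @ [h])"
        using steps_split[of as b "bs @ b # cs @ [h]"] steps_split[of "b # bs" b "cs @ [h]"]
        unfolding xs by simp blast
      have w: "walk_weight d xs = walk_weight d (as @ b # cs @ [h]) + walk_weight d (b # bs @ [b])"
        using walk_weight_split[of d as b "bs @ b # cs @ [h]"]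
          walk_weight_split[of d "b # bs" b "cs @ [h]"] walk_weight_split[of d as b "cs @ [h]"]
        unfolding xs by simp
      have "0 \<le> walk_weight d (b # bs @ [b])"
        using less.prems S by (intro less.hyps) (auto simp: xs)
      moreover have "0 \<le> walk_weight d (as @ b # cs @ [h])"
        using less.prems S steps_split[of as b "cs @ [h]"] h
        by (intro less.hyps) (auto simp: xs hd_append)
      ultimately show ?thesis using w by simp
    next
      case dist: True
      show ?thesis
      proof (cases "\<exists>i k l. k < l \<and> Suc l < length xs \<and> {xs ! k, xs ! Suc k, xs ! l, xs ! Suc l} \<subseteq> S i")
        case True
        then obtain i k l where kl: "k < l" "Suc l < length xs"
          and Si: "{xs ! k, xs ! Suc k, xs ! l, xs ! Suc l} \<subseteq> S i" by blast
        define as where "as = take k xs"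
        define cs where "cs = drop (Suc (Suc l)) xs"
        define ts where "ts = take (l - k) (drop (Suc k) xs)"
        define u where "u = xs ! k"
        define w' where "w' = xs ! Suc l"
        have lts: "length ts = l - k" unfolding ts_def using kl by simp
        then have tsne: "ts \<noteq> []" using kl by auto
        have tsh: "hd ts = xs ! Suc k"
          using hd_conv_nth[OF tsne] kl unfolding ts_def by simp
        have tsl: "last ts = xs ! l"
          using last_conv_nth[OF tsne] kl lts unfolding ts_def by simp
        have "xs = take k xs @ xs ! k # drop (Suc k) xs"
          using kl by (intro id_take_nth_drop) simp
        moreover have "drop (Suc k) xs = ts @ drop (l - k) (drop (Suc k) xs)"
          unfolding ts_def by (simp only: append_take_drop_id)
        moreover have "drop (l - k) (drop (Suc k) xs) = w' # cs"
          unfolding w'_def cs_def using kl by (simp add: Cons_nth_drop_Suc)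
        ultimately have xs: "xs = as @ u # ts @ w' # cs"
          unfolding as_def u_def by metis
        let ?w = "hd ts" and ?u' = "last ts"
        have Si': "u \<in> S i" "?w \<in> S i" "?u' \<in> S i" "w' \<in> S i"
          using Si tsh tsl u_def w'_def by auto
        have e1: "steps (u # ts @ w' # cs) = insert (u, ?w) (steps (ts @ w' # cs))"
          using tsne by (cases ts) auto
        have e2: "steps (ts @ w' # cs) = steps ts \<union> insert (?u', w') (steps (w' # cs))"
          using tsne by (rule steps_append)
        have e3: "steps (ts @ [?w]) = steps ts \<union> {(?u', ?w)}"
          using steps_append[OF tsne] by simp
        have f1: "walk_weight d (u # ts @ w' # cs) = d u ?w + walk_weight d (ts @ w' # cs)"
          using tsne by (cases ts) auto
        have f2: "walk_weight d (ts @ w' # cs) = walk_weight d ts + (d ?u' w' + walk_weight d (w' # cs))"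
          using tsne by (rule walk_weight_append)
        have f3: "walk_weight d (ts @ [?w]) = walk_weight d ts + d ?u' ?w"
          using walk_weight_append[OF tsne, of d ?w "[]"] by simp
        have g1: "steps xs = steps (as @ [u]) \<union> steps (u # ts @ w' # cs)"
          unfolding xs by (rule steps_split)
        have g2: "walk_weight d xs = walk_weight d (as @ [u]) + walk_weight d (u # ts @ w' # cs)"
          unfolding xs by (rule walk_weight_split)
        have "0 \<le> walk_weight d (ts @ [?w])"
        proof (rule less.hyps)
          show "length (ts @ [?w]) < length xs" unfolding xs by simp
          have "steps ts \<subseteq> E" using less.prems g1 e1 e2 by blast
          then show "steps (ts @ [?w]) \<subseteq> E" using e3 side[of i] Si' by auto
        qed (use tsne in auto)
        moreover have "0 \<le> walk_weight d (as @ u # w' # cs)"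
        proof (rule less.hyps)
          show "length (as @ u # w' # cs) < length xs" unfolding xs using tsne by simp
          show "steps (as @ u # w' # cs) \<subseteq> E"
            using steps_split[of as u "w' # cs"] less.prems g1 e1 e2 side[of i] Si' by auto
          show "hd (as @ u # w' # cs) = last (as @ u # w' # cs)"
            using less.prems(3) unfolding xs by (cases as) auto
        qed auto
        moreover have "walk_weight d xs = walk_weight d (ts @ [?w]) + walk_weight d (as @ u # w' # cs)"
          using walk_weight_split[of d as u "w' # cs"] g2 f1 f2 f3 exchange[of u i ?w ?u' w'] Si' by simp
        ultimately show ?thesis by simp
      next
        case False
        have "0 \<le> walk_weight d (ys @ [hd ys])"
        proof (rule simple)
          show "steps (ys @ [hd ys]) \<subseteq> E" using less.prems ys by simp
          fix i e e'
          assume e: "e \<in> steps (ys @ [hd ys])" "e' \<in> steps (ys @ [hd ys])" "e \<noteq> e'"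
          show "\<not> (e \<in> S i \<times> S i \<and> e' \<in> S i \<times> S i)"
          proof
            assume *: "e \<in> S i \<times> S i \<and> e' \<in> S i \<times> S i"
            from e ys(1) obtain k l where "Suc k < length xs" "Suc l < length xs"
              "e = (xs ! k, xs ! Suc k)" "e' = (xs ! l, xs ! Suc l)"
              unfolding steps_nth by auto
            moreover from this have "k \<noteq> l" using e(3) by auto
            ultimately show False using * False
              by (cases k l rule: linorder_cases) auto
          qed
        qed (use ys dist in auto)
        then show ?thesis using ys by simp
      qed
    qed
  qed
qed

subsection \<open>Simple closed curves made of arcs\<close>

text \<open>The recursion stops at two vertices: joining a final constant path would destroy
  injectivity, hence the property \<open>arc\<close>. Fewer than two vertices determine no
  path.\<close>

fun path_through :: "('a \<Rightarrow> 'a \<Rightarrow> real \<Rightarrow> 'b::topological_space) \<Rightarrow> 'a list \<Rightarrow> real \<Rightarrow> 'b" where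
  "path_through g (x # y # z # zs) = g x y +++ path_through g (y # z # zs)"
| "path_through g (x # y # []) = g x y"
| "path_through g _ = undefined"

text \<open>The first arc may meet the rest only in common end points of edges, and \<open>x\<close>
  does not recur in a distinct list; so only \<open>y\<close> remains and \<open>arc_join\<close>
  applies.\<close>

lemma arc_path_through:
  fixes g :: "'a::t2_space \<Rightarrow> 'a \<Rightarrow> real \<Rightarrow> 'a"
  assumes "distinct xs" "2 \<le> length xs"
    and "\<And>x y. (x, y) \<in> steps xs \<Longrightarrow> arc (g x y) \<and> pathstart (g x y) = x \<and> pathfinish (g x y) = y"
    and "\<And>x y x' y'. \<lbrakk>(x, y) \<in> steps xs; (x', y') \<in> steps xs; (x, y) \<noteq> (x', y')\<rbrakk>
      \<Longrightarrow> path_image (g x y) \<inter> path_image (g x' y') \<subseteq> {x, y} \<inter> {x', y'}"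
  shows "arc (path_through g xs) \<and> pathstart (path_through g xs) = hd xs \<and>
    pathfinish (path_through g xs) = last xs \<and>
    path_image (path_through g xs) = (\<Union>(x, y) \<in> steps xs. path_image (g x y))"
  using assms
proof (induction g xs rule: path_through.induct)
  case (1 g x y z zs)
  let ?r = "y # z # zs"
  have IH: "arc (path_through g ?r) \<and> pathstart (path_through g ?r) = hd ?r \<and>
    pathfinish (path_through g ?r) = last ?r \<and>
    path_image (path_through g ?r) = (\<Union>(x, y) \<in> steps ?r. path_image (g x y))"
    by (rule "1.IH") (use "1.prems" in auto)
  have g: "arc (g x y)" "pathstart (g x y) = x" "pathfinish (g x y) = y"
    using "1.prems"(3)[of x y] by auto
  have int: "path_image (g x y) \<inter> path_image (path_through g ?r) \<subseteq> {y}"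
  proof
    fix w assume w: "w \<in> path_image (g x y) \<inter> path_image (path_through g ?r)"
    then obtain x' y' where s: "(x', y') \<in> steps ?r" "w \<in> path_image (g x' y')"
      using IH by auto
    then have "x' \<in> set ?r" "y' \<in> set ?r"
      using steps_subset[of ?r] by auto
    then have "x \<noteq> x'" "x \<noteq> y'" using "1.prems"(1) by auto
    moreover have "w \<in> {x, y} \<inter> {x', y'}"
      using "1.prems"(4)[of x y x' y'] s w calculation by auto
    ultimately show "w \<in> {y}" by auto
  qed
  have "arc (g x y +++ path_through g ?r)"
    using g IH int by (intro arc_join) auto
  then show ?case
    using g IH by (auto simp: path_image_join)
next
  case (2 g x y)
  then show ?case by auto
qed auto

lemma winding_number_path_through:
  assumes "2 \<le> length xs"
    and "\<And>x y. (x, y) \<in> steps xs \<Longrightarrow> path (g x y) \<and> pathstart (g x y) = x \<and> pathfinish (g x y) = y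
        \<and> p \<notin> path_image (g x y)"
  shows "path (path_through g xs) \<and> p \<notin> path_image (path_through g xs) \<and>
     pathstart (path_through g xs) = hd xs \<and> pathfinish (path_through g xs) = last xs \<and>
     winding_number (path_through g xs) p = walk_weight (\<lambda>x y. winding_number (g x y) p) xs"
  using assms
  by (induction g xs rule: path_through.induct)
     (auto simp: winding_number_join not_in_path_image_join)

text \<open>The arcs along \<open>xs\<close> form an arc, which the closing one completes to a
  simple closed path. With only two vertices the closing arc could retrace the first one.\<close>

lemma simple_cycle_winding_number:
  fixes g :: "complex \<Rightarrow> complex \<Rightarrow> real \<Rightarrow> complex"
  assumes "distinct xs" "3 \<le> length xs"
    and arc: "\<And>x y. (x, y) \<in> steps (xs @ [hd xs])
      \<Longrightarrow> arc (g x y) \<and> pathstart (g x y) = x \<and> pathfinish (g x y) = y \<and> p \<notin> path_image (g x y)"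
    and int: "\<And>x y x' y'. \<lbrakk>(x, y) \<in> steps (xs @ [hd xs]); (x', y') \<in> steps (xs @ [hd xs]);
        {x, y} \<noteq> {x', y'}\<rbrakk>
      \<Longrightarrow> path_image (g x y) \<inter> path_image (g x' y') \<subseteq> {x, y} \<inter> {x', y'}"
  shows "walk_weight (\<lambda>x y. winding_number (g x y) p) (xs @ [hd xs]) \<in> {-1, 0, 1}"
proof -
  define l where "l = last xs"
  define h where "h = hd xs"
  obtain ys where ys: "xs = ys @ [l]"
    using assms(2) l_def by (metis append_butlast_last_id list.size(3) not_numeral_le_zero)
  have S: "steps (xs @ [h]) = insert (l, h) (steps xs)"
    using steps_split[of ys l "[h]"] ys by simp
  have hl: "h = xs ! 0" "l = xs ! (length xs - 1)"
    using assms(2) unfolding h_def l_def by (cases xs; simp add: last_conv_nth hd_conv_nth)+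
  \<comment> \<open>\<open>int\<close> compares unordered pairs, so different steps must have
    different vertex sets. Only the closing step could reverse another one, and only in a cycle of
    two vertices.\<close>
  have ne: "{x, y} \<noteq> {x', y'}"
    if "(x, y) \<in> steps (xs @ [h])" "(x', y') \<in> steps xs" "(x, y) \<noteq> (x', y')" for x y x' y'
  proof -
    note st = that
    obtain j where j: "x' = xs ! j" "y' = xs ! Suc j" "Suc j < length xs"
      using st(2) unfolding steps_nth by auto
    have inj: "xs ! k = xs ! m \<longleftrightarrow> k = m" if "k < length xs" "m < length xs" for k m
      using nth_eq_iff_index_eq[OF assms(1)] that by simp
    consider "(x, y) = (l, h)" | i where "x = xs ! i" "y = xs ! Suc i" "Suc i < length xs"
      using st(1) S by (auto simp: steps_nth[of xs])
    then show ?thesis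
    proof cases
      case 1
      have 0: "0 < length xs" "length xs - 1 < length xs" using assms(2) by auto
      have "j < length xs" using j(3) by simp
      have "l \<noteq> x'"
      proof
        assume "l = x'"
        then have "length xs - 1 = j" using inj[OF 0(2) \<open>j < length xs\<close>] hl(2) j(1) by metis
        then show False using j(3) by simp
      qed
      moreover have "\<not> (l = y' \<and> h = x')"
      proof
        assume a: "l = y' \<and> h = x'"
        then have "length xs - 1 = Suc j" using inj[OF 0(2) j(3)] hl(2) j(2) by metis
        moreover have "0 = j" using a inj[OF 0(1) \<open>j < length xs\<close>] hl(1) j(1) by metis
        ultimately show False using assms(2) by simp
      qed
      ultimately show ?thesis using 1 by (auto simp: doubleton_eq_iff)
    next
      case (2 i)
      have "i \<noteq> j" using 2 j st(3) by auto
      moreover have "x = x' \<longleftrightarrow> i = j" "x = y' \<longleftrightarrow> i = Suc j" "y = x' \<longleftrightarrow> Suc i = j"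
        unfolding 2 j by (rule inj; use 2 j in simp)+
      ultimately show ?thesis by (auto simp: doubleton_eq_iff)
    qed
  qed
  have lh: "(l, h) \<notin> steps xs"
  proof
    assume "(l, h) \<in> steps xs"
    then obtain j where "l = xs ! j" "Suc j < length xs" unfolding steps_nth by auto
    then show False using hl(2) nth_eq_iff_index_eq[OF assms(1), of j "length xs - 1"] assms(2) by simp
  qed
  let ?P = "path_through g xs"
  have P: "arc ?P \<and> pathstart ?P = hd xs \<and> pathfinish ?P = last xs \<and>
      path_image ?P = (\<Union>(x, y) \<in> steps xs. path_image (g x y))"
  proof (rule arc_path_through)
    fix x y x' y'
    assume e: "(x, y) \<in> steps xs" "(x', y') \<in> steps xs" "(x, y) \<noteq> (x', y')"
    show "path_image (g x y) \<inter> path_image (g x' y') \<subseteq> {x, y} \<inter> {x', y'}"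
      by (rule int) (use e S ne h_def in auto)
  qed (use assms(1,2) arc S h_def in auto)
  have W: "path ?P \<and> p \<notin> path_image ?P \<and> pathstart ?P = hd xs \<and> pathfinish ?P = last xs \<and>
     winding_number ?P p = walk_weight (\<lambda>x y. winding_number (g x y) p) xs"
    by (rule winding_number_path_through) (use assms(2) arc S h_def arc_imp_path in auto)
  have c: "arc (g l h)" "pathstart (g l h) = l" "pathfinish (g l h) = h" "p \<notin> path_image (g l h)"
    using arc[of l h] S h_def by auto
  have "path_image ?P \<inter> path_image (g l h) \<subseteq> {h, l}"
  proof
    fix w assume w: "w \<in> path_image ?P \<inter> path_image (g l h)"
    then obtain x y where "(x, y) \<in> steps xs" "w \<in> path_image (g x y)" using P by auto
    moreover have "path_image (g l h) \<inter> path_image (g x y) \<subseteq> {l, h} \<inter> {x, y}"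
      by (rule int) (use ne[of l h x y] S h_def calculation lh in auto)
    ultimately show "w \<in> {h, l}" using w by auto
  qed
  then have "simple_path (?P +++ g l h)"
    using P c by (intro simple_path_join_loop) (auto simp: l_def h_def)
  moreover have "p \<notin> path_image (?P +++ g l h)"
    using W c by (simp add: not_in_path_image_join)
  ultimately have "winding_number (?P +++ g l h) p \<in> {-1, 0, 1}"
    using simple_closed_path_winding_number_cases[of "?P +++ g l h" p] P c by (auto simp: h_def)
  moreover have "winding_number (?P +++ g l h) p = winding_number ?P p + winding_number (g l h) p"
    using W c by (intro winding_number_join) (auto simp: arc_imp_path l_def)
  moreover have "walk_weight (\<lambda>x y. winding_number (g x y) p) (xs @ [h])
      = walk_weight (\<lambda>x y. winding_number (g x y) p) xs + winding_number (g l h) p"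
    using walk_weight_split[of "\<lambda>x y. winding_number (g x y) p" ys l "[h]"] ys by simp
  ultimately show ?thesis using W h_def by simp
qed

subsection \<open>Angles and winding\<close>

text \<open>The signed angle, in full turns, swept as seen from \<open>p\<close>. The imaginary
  part, dropped here, records only the change of the distance to \<open>p\<close>.\<close>

definition angle_turn :: "complex \<Rightarrow> complex \<Rightarrow> complex \<Rightarrow> real" where
  "angle_turn p x y = Re (winding_number (linepath x y) p)"

text \<open>The signed number of crossings of the segment with the branch cut of \<^const>\<open>Arg\<close> at \<open>p\<close>.\<close>

definition turn_offset :: "complex \<Rightarrow> complex \<Rightarrow> complex \<Rightarrow> int" where
  "turn_offset p x y = \<lfloor>angle_turn p x y - (Arg (y - p) - Arg (x - p)) / (2 * pi)\<rfloor>"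

text \<open>The exponential of the winding number is the quotient of \<open>y - p\<close> and
  \<open>x - p\<close>. After division by the norms only angles remain, which agree up to whole
  turns; so the floor in \<open>turn_offset\<close> is applied to an integer.\<close>

lemma angle_turn_eq:
  assumes "p \<notin> closed_segment x y"
  shows "angle_turn p x y = Arg (y - p) / (2 * pi) - Arg (x - p) / (2 * pi) + real_of_int (turn_offset p x y)"
proof -
  have xy: "x \<noteq> p" "y \<noteq> p" using assms by auto
  define w where "w = winding_number (linepath x y) p"
  have "y - p = exp (2 * pi * \<i> * w) * (x - p)"
    using winding_number_exp_2pi[of "linepath x y" p] assms unfolding w_def by simp
  then have "sgn (y - p) = sgn (exp (2 * pi * \<i> * w)) * sgn (x - p)"
    by (metis sgn_mult)
  moreover have "sgn (exp (2 * pi * \<i> * w)) = cis (2 * pi * Re w)"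
    by (simp add: exp_eq_polar sgn_div_norm norm_mult scaleR_conv_of_real)
  ultimately have "cis (Arg (y - p)) = cis (2 * pi * Re w) * cis (Arg (x - p))"
    using xy by (simp add: cis_Arg)
  moreover have "cis (2 * pi * Re w - (Arg (y - p) - Arg (x - p)))
      = cis (2 * pi * Re w) * cis (Arg (x - p)) / cis (Arg (y - p))"
    by (simp add: cis_mult cis_divide algebra_simps)
  ultimately have "cis (2 * pi * Re w - (Arg (y - p) - Arg (x - p))) = 1"
    by (metis cis_neq_zero divide_self)
  then have "cos (2 * pi * Re w - (Arg (y - p) - Arg (x - p))) = 1"
    by (metis cis.simps(1) one_complex.simps(1))
  then obtain n :: int where "2 * pi * Re w - (Arg (y - p) - Arg (x - p)) = of_int n * 2 * pi"
    using cos_one_2pi_int by auto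
  then have n: "angle_turn p x y - (Arg (y - p) - Arg (x - p)) / (2 * pi) = of_int n"
    unfolding angle_turn_def w_def[symmetric] by (simp add: field_simps)
  then have "turn_offset p x y = n" unfolding turn_offset_def by simp
  then show ?thesis using n by (simp add: diff_divide_distrib)
qed

lemma angle_turn_refl: "p \<noteq> x \<Longrightarrow> angle_turn p x x = 0"
  by (simp add: angle_turn_def)

lemma angle_turn_commute: "p \<notin> closed_segment x y \<Longrightarrow> angle_turn p y x = - angle_turn p x y"
  using winding_number_reversepath[of "linepath x y" p] by (simp add: angle_turn_def)

lemma turn_offset_refl: "p \<noteq> x \<Longrightarrow> turn_offset p x x = 0"
  using angle_turn_eq[of p x x] angle_turn_refl[of p x] by simp

lemma turn_offset_commute: "p \<notin> closed_segment x y \<Longrightarrow> turn_offset p y x = - turn_offset p x y"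
  using angle_turn_eq[of p x y] angle_turn_eq[of p y x] angle_turn_commute[of p x y]
  by (simp add: closed_segment_commute)

lemma winding_number_triangle_eq:
  assumes "p \<notin> closed_segment x y" "p \<notin> closed_segment y z" "p \<notin> closed_segment z x"
  shows "Re (winding_number (linepath x y +++ linepath y z +++ linepath z x) p)
    = angle_turn p x y + angle_turn p y z + angle_turn p z x"
  using assms by (simp add: winding_number_join not_in_path_image_join angle_turn_def)

text \<open>The \<open>Arg\<close> terms cancel around the triangle.\<close>

lemma turn_offset_triangle:
  assumes "p \<notin> closed_segment x y" "p \<notin> closed_segment y z" "p \<notin> closed_segment z x"
  shows "real_of_int (turn_offset p x y + turn_offset p y z + turn_offset p z x)
    = angle_turn p x y + angle_turn p y z + angle_turn p z x"
  using angle_turn_eq[OF assms(1)] angle_turn_eq[OF assms(2)] angle_turn_eq[OF assms(3)] by simp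

text \<open>The boundary of the triangle stays in \<open>C\<close> and so does not wind around
  \<open>p\<close>.\<close>

lemma angle_turn_convex:
  assumes "convex C" "p \<notin> C" "x \<in> C" "y \<in> C" "z \<in> C"
  shows "angle_turn p x y + angle_turn p y z + angle_turn p z x = 0"
proof -
  have s: "closed_segment x y \<subseteq> C" "closed_segment y z \<subseteq> C" "closed_segment z x \<subseteq> C"
    using assms by (simp_all add: closed_segment_subset)
  then have n: "p \<notin> closed_segment x y" "p \<notin> closed_segment y z" "p \<notin> closed_segment z x"
    using assms(2) by auto
  have "winding_number (linepath x y +++ linepath y z +++ linepath z x) p = 0"
    by (rule winding_number_zero_outside[OF _ assms(1) _ assms(2)]) (use s in \<open>auto simp: path_image_join\<close>)
  then show ?thesis using winding_number_triangle_eq[OF n] by simp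
qed

lemma turn_offset_convex:
  assumes "convex C" "p \<notin> C" "x \<in> C" "y \<in> C" "z \<in> C"
  shows "turn_offset p x y + turn_offset p y z + turn_offset p z x = 0"
proof -
  have "closed_segment x y \<subseteq> C" "closed_segment y z \<subseteq> C" "closed_segment z x \<subseteq> C"
    using assms by (simp_all add: closed_segment_subset)
  then show ?thesis
    using turn_offset_triangle[of p x y z] angle_turn_convex[OF assms] assms(2)
    by (metis of_int_eq_0_iff subsetD)
qed

lemma turn_offset_interior:
  assumes "p \<in> interior (convex hull {x, y, z})"
  shows "\<bar>turn_offset p x y + turn_offset p y z + turn_offset p z x\<bar> = 1"
proof -
  have n: "p \<notin> closed_segment x y" "p \<notin> closed_segment y z" "p \<notin> closed_segment z x"
    using assms interior_of_triangle[of x y z] by (auto simp: closed_segment_commute)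
  have "\<bar>angle_turn p x y + angle_turn p y z + angle_turn p z x\<bar> = 1"
    unfolding winding_number_triangle_eq[OF n, symmetric] winding_number_triangle[OF assms] by simp
  then have "\<bar>real_of_int (turn_offset p x y + turn_offset p y z + turn_offset p z x)\<bar> = 1"
    unfolding turn_offset_triangle[OF n] .
  then show ?thesis by linarith
qed

text \<open>The triangles \<open>x, y, y'\<close> and \<open>x', y', y\<close> both have total
  offset 0; in the sum, their common edge cancels. This provides the exchange of chords on one
  side.\<close>

lemma turn_offset_exchange:
  assumes "convex C" "p \<notin> C" "x \<in> C" "y \<in> C" "x' \<in> C" "y' \<in> C"
  shows "turn_offset p x y + turn_offset p x' y' = turn_offset p x y' + turn_offset p x' y"
proof -
  have "closed_segment y' x \<subseteq> C" "closed_segment y x' \<subseteq> C" "closed_segment y' y \<subseteq> C"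
    using assms by (simp_all add: closed_segment_subset)
  then have "p \<notin> closed_segment y' x" "p \<notin> closed_segment y x'" "p \<notin> closed_segment y' y"
    using assms(2) by auto
  then show ?thesis
    using turn_offset_convex[OF assms(1,2,3,4,6)] turn_offset_convex[OF assms(1,2,5,6,4)]
      turn_offset_commute[of p y' x] turn_offset_commute[of p y x'] turn_offset_commute[of p y' y]
    by simp
qed

subsection \<open>The coordinate triangle\<close>

text \<open>For \<open>i < 3\<close>, the barycentric coordinates with respect to the triangle 0, 1,
  \<i>.\<close>

definition bary :: "nat \<Rightarrow> complex \<Rightarrow> real" where
  "bary i z = (if i = 0 then 1 - Re z - Im z else if i = 1 then Re z else Im z)"

definition corner :: "nat \<Rightarrow> complex" where
  "corner i = (if i = 0 then 0 else if i = 1 then 1 else \<i>)"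

lemma less_3_iff: "i < (3::nat) \<longleftrightarrow> i = 0 \<or> i = 1 \<or> i = 2"
  by auto

lemma bary_corner: "i < 3 \<Longrightarrow> j < 3 \<Longrightarrow> bary i (corner j) = (if i = j then 1 else 0)"
  by (auto simp: bary_def corner_def less_3_iff)

lemma bary_convex_comb: "bary i ((1 - t) *\<^sub>R x + t *\<^sub>R y) = (1 - t) * bary i x + t * bary i y"
  by (simp add: bary_def algebra_simps)

lemma convex_bary_nonpos: "convex {z. bary i z \<le> 0}"
  unfolding convex_alt
  by (auto simp: bary_convex_comb intro!: add_nonpos_nonpos mult_nonneg_nonpos)

lemma convex_bary_nonneg: "convex {z. 0 \<le> bary i z}"
  unfolding convex_alt
  by (auto simp: bary_convex_comb)

lemma bary_inject:
  assumes "i < 3" "j < 3" "i \<noteq> j" "bary i x = bary i y" "bary j x = bary j y"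
  shows "x = y"
  using assms unfolding less_3_iff bary_def by (auto intro!: complex_eqI)

lemma interior_corner_triangle:
  assumes "\<forall>i<3. 0 < bary i p"
  shows "p \<in> interior (convex hull {corner 0, corner 1, corner 2})"
proof (rule interiorI)
  let ?U = "{z. 0 < 1 - Re z - Im z} \<inter> {z. 0 < Re z} \<inter> {z. 0 < Im z}"
  show "open ?U"
    by (intro open_Int open_Collect_less continuous_intros)
  show "p \<in> ?U" using assms by (auto simp: less_3_iff bary_def)
  show "?U \<subseteq> convex hull {corner 0, corner 1, corner 2}"
  proof
    fix z assume "z \<in> ?U"
    moreover have "z = (1 - Re z - Im z) *\<^sub>R corner 0 + Re z *\<^sub>R corner 1 + Im z *\<^sub>R corner 2"
      by (auto simp: corner_def intro: complex_eqI)
    ultimately show "z \<in> convex hull {corner 0, corner 1, corner 2}"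
      unfolding convex_hull_3 by (intro CollectI exI[of _ "1 - Re z - Im z"] exI[of _ "Re z"] exI[of _ "Im z"]) auto
  qed
qed

text \<open>A detour outside the triangle, beyond the side opposite to corner \<open>i\<close>.\<close>

definition bulge :: "nat \<Rightarrow> complex \<Rightarrow> complex \<Rightarrow> real \<Rightarrow> complex" where
  "bulge i x y = linepath x (x + y - corner i) +++ linepath (x + y - corner i) y"

text \<open>The coefficients 1, 1, -1 of the tip sum to 1, so it is an affine combination and its
  coordinates combine in the same way.\<close>

lemma bary_bulge_tip:
  assumes "i < 3" "j < 3"
  shows "bary j (x + y - corner i) = bary j x + bary j y - (if i = j then 1 else 0)"
  using assms unfolding less_3_iff by (auto simp: bary_def corner_def)

lemma path_image_bulge:
  "path_image (bulge i x y) = closed_segment x (x + y - corner i) \<union> closed_segment (x + y - corner i) y"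
  by (simp add: bulge_def path_image_join)

locale chord =
  fixes i x y
  assumes i: "i < 3" and ne: "x \<noteq> y" and on_side: "bary i x = 0" "bary i y = 0"
    and nonneg: "\<forall>j<3. 0 \<le> bary j x" "\<forall>j<3. 0 \<le> bary j y"
begin

text \<open>If coordinate \<open>j\<close> vanished at both \<open>x\<close> and \<open>y\<close>,
  they would be the same corner.\<close>

lemma bary_tip: "bary i (x + y - corner i) = -1" "j < 3 \<Longrightarrow> j \<noteq> i \<Longrightarrow> 0 < bary j (x + y - corner i)"
proof -
  show "bary i (x + y - corner i) = -1"
    using i on_side by (simp add: bary_bulge_tip)
  assume j: "j < 3" "j \<noteq> i"
  have "\<not> (bary j x = 0 \<and> bary j y = 0)"
    using bary_inject[of i j x y] i j ne on_side by auto
  moreover have "0 \<le> bary j x" "0 \<le> bary j y" using nonneg j by auto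
  ultimately have "0 < bary j x + bary j y" by linarith
  then show "0 < bary j (x + y - corner i)"
    using i j by (simp add: bary_bulge_tip)
qed

lemma bulge_segment:
  assumes "z \<in> closed_segment u (x + y - corner i)" "u = x \<or> u = y" "z \<noteq> u"
  shows "bary i z < 0 \<and> (\<forall>j<3. j \<noteq> i \<longrightarrow> 0 < bary j z)"
proof -
  obtain t where t: "0 \<le> t" "t \<le> 1" "z = (1 - t) *\<^sub>R u + t *\<^sub>R (x + y - corner i)"
    using assms(1) by (auto simp: closed_segment_def)
  then have "0 < t" using assms(3) by (cases "t = 0") auto
  have "bary i z = - t"
    unfolding t(3) bary_convex_comb bary_tip using on_side assms(2) by auto
  moreover have "0 < bary j z" if "j < 3" "j \<noteq> i" for j
  proof -
    have "0 \<le> bary j u" using assms(2) nonneg that by auto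
    then show ?thesis
      unfolding t(3) bary_convex_comb using bary_tip(2)[OF that] t \<open>0 < t\<close>
      by (intro add_nonneg_pos) auto
  qed
  ultimately show ?thesis using \<open>0 < t\<close> by auto
qed

text \<open>Keeps a bulge, apart from its end points, off the triangle and off the bulges beyond
  other sides: the negative coordinate tells these regions apart.\<close>

lemma bulge_outside:
  assumes "z \<in> path_image (bulge i x y)" "z \<noteq> x" "z \<noteq> y"
  shows "bary i z < 0 \<and> (\<forall>j<3. j \<noteq> i \<longrightarrow> 0 < bary j z)"
  using assms bulge_segment[of z x] bulge_segment[of z y]
  unfolding path_image_bulge by (auto simp: closed_segment_commute)

text \<open>On either segment, coordinate \<open>i\<close> is minus the parameter counted from the
  side. A common point thus has one parameter \<open>t\<close> on both, and
  \<open>x \<noteq> y\<close> forces \<open>t = 1\<close>, the tip.\<close>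

lemma arc_bulge: "arc (bulge i x y)"
proof -
  let ?m = "x + y - corner i"
  have m: "x \<noteq> ?m" "y \<noteq> ?m" using bary_tip(1) on_side by (metis zero_neq_neg_one)+
  have "z = ?m" if z: "z \<in> closed_segment x ?m" "z \<in> closed_segment ?m y" for z
  proof -
    obtain t where t: "z = (1 - t) *\<^sub>R x + t *\<^sub>R ?m"
      using z(1) by (auto simp: closed_segment_def)
    obtain s where s: "z = (1 - s) *\<^sub>R y + s *\<^sub>R ?m"
      using z(2) unfolding closed_segment_commute[of ?m] by (auto simp: closed_segment_def)
    have "bary i z = - t"
      unfolding t bary_convex_comb bary_tip using on_side by simp
    moreover have "bary i z = - s"
      unfolding s bary_convex_comb bary_tip using on_side by simp
    ultimately have "t = s" by simp
    then have "(1 - t) *\<^sub>R x + t *\<^sub>R ?m = (1 - t) *\<^sub>R y + t *\<^sub>R ?m"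
      using s t by metis
    then have "t = 1" using ne by simp
    then show ?thesis using t by simp
  qed
  then show ?thesis
    unfolding bulge_def using m by (intro arc_join) auto
qed

text \<open>Chord and bulge lie in a half plane that misses \<open>p\<close>, so they sweep the same
  angle.\<close>

lemma bulge_winding:
  assumes "0 < bary i p"
  shows "p \<notin> path_image (bulge i x y)" "Re (winding_number (bulge i x y) p) = angle_turn p x y"
proof -
  let ?m = "x + y - corner i"
  let ?C = "{z. bary i z \<le> 0}"
  have C: "x \<in> ?C" "y \<in> ?C" "?m \<in> ?C" "p \<notin> ?C"
    using on_side bary_tip(1) assms by auto
  have s: "closed_segment x ?m \<subseteq> ?C" "closed_segment ?m y \<subseteq> ?C" "closed_segment x y \<subseteq> ?C"
    using C by (simp_all only: closed_segment_subset[OF _ _ convex_bary_nonpos])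
  then have n: "p \<notin> closed_segment x ?m" "p \<notin> closed_segment ?m y" "p \<notin> closed_segment x y"
    using C(4) by blast+
  then show "p \<notin> path_image (bulge i x y)"
    by (simp add: path_image_bulge)
  have "Re (winding_number (bulge i x y) p) = angle_turn p x ?m + angle_turn p ?m y"
    unfolding bulge_def angle_turn_def using n by (subst winding_number_join) auto
  also have "\<dots> = angle_turn p x y"
    using angle_turn_convex[OF convex_bary_nonpos C(4,1,3,2)] angle_turn_commute[OF n(3)] by simp
  finally show "Re (winding_number (bulge i x y) p) = angle_turn p x y" .
qed

end

subsection \<open>Labellings from integer potentials\<close>

lemma Re_walk_weight: "Re (walk_weight d xs) = walk_weight (\<lambda>x y. Re (d x y)) xs"
  by (induction d xs rule: walk_weight.induct) auto

lemma of_int_walk_weight: "real_of_int (walk_weight d xs) = walk_weight (\<lambda>x y. real_of_int (d x y)) xs"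
  by (induction d xs rule: walk_weight.induct) auto

lemma walk_weight_cong:
  "(\<And>x y. (x, y) \<in> steps xs \<Longrightarrow> d x y = d' x y) \<Longrightarrow> walk_weight d xs = walk_weight d' xs"
  by (induction xs rule: induct_list012) auto

lemma walk_weight_affine:
  fixes c :: "'a \<Rightarrow> 'a \<Rightarrow> int"
  shows "walk_weight (\<lambda>x y. 1 - 3 * c x y) xs = int (length xs - 1) - 3 * walk_weight c xs"
  by (induction xs rule: induct_list012) auto

text \<open>What the argument needs of the triangulation: its edges, in both directions, drawn
  without crossings in the coordinate triangle, and a point \<open>p\<close> off all of them. Small
  triangles enter only as three-cycles of edges.\<close>

locale plane_drawing =
  fixes V :: "complex set" and E :: "(complex \<times> complex) set" and p :: complex
  assumes finite_V: "finite V"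
    and nonneg: "\<And>i z. i < 3 \<Longrightarrow> z \<in> V \<Longrightarrow> 0 \<le> bary i z"
    and corner_V: "\<And>i. i < 3 \<Longrightarrow> corner i \<in> V"
    and E_V: "E \<subseteq> V \<times> V"
    and sym_E: "sym E"
    and irrefl_E: "(x, y) \<in> E \<Longrightarrow> x \<noteq> y"
    and p_pos: "\<And>i. i < 3 \<Longrightarrow> 0 < bary i p"
    and p_notin: "(x, y) \<in> E \<Longrightarrow> p \<notin> closed_segment x y"
    and vertex_on_edge: "(x, y) \<in> E \<Longrightarrow> z \<in> V \<Longrightarrow> z \<in> closed_segment x y \<Longrightarrow> z \<in> {x, y}"
    and edge_int: "(x, y) \<in> E \<Longrightarrow> (x', y') \<in> E \<Longrightarrow> {x, y} \<noteq> {x', y'}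
      \<Longrightarrow> closed_segment x y \<inter> closed_segment x' y' \<subseteq> {x, y} \<inter> {x', y'}"
begin

text \<open>The value for \<open>i \<ge> 3\<close> lets \<open>nat\<close> index the family
  \<open>S\<close> of \<open>closed_walk_weight_nonneg\<close>.\<close>

definition side :: "nat \<Rightarrow> complex set" where
  "side i = (if i < 3 then {z \<in> V. bary i z = 0} else {})"

text \<open>Besides the chords, this contains loops at the vertices on the sides, which the exchange
  of chords can produce.\<close>

definition G :: "(complex \<times> complex) set" where
  "G = E \<union> (\<Union>i. side i \<times> side i)"

text \<open>Only the end points are tested, so an edge of \<open>E\<close> along the boundary is
  bulged too. For distinct end points the side is unique, since two sides share only a
  corner.\<close>

definition crossing_path :: "complex \<Rightarrow> complex \<Rightarrow> real \<Rightarrow> complex" where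
  "crossing_path x y = (if \<exists>i. x \<in> side i \<and> y \<in> side i
     then bulge (SOME i. x \<in> side i \<and> y \<in> side i) x y else linepath x y)"

lemma side_subset: "side i \<subseteq> V" "z \<in> side i \<Longrightarrow> i < 3" "z \<in> side i \<Longrightarrow> bary i z = 0"
  by (auto simp: side_def split: if_splits)

lemma chord_side: "x \<in> side i \<Longrightarrow> y \<in> side i \<Longrightarrow> x \<noteq> y \<Longrightarrow> chord i x y"
  using side_subset nonneg by unfold_locales (blast | simp)+

lemma G_V: "G \<subseteq> V \<times> V"
  using E_V side_subset(1) unfolding G_def by blast

lemma G_sym: "(x, y) \<in> G \<Longrightarrow> (y, x) \<in> G"
  using sym_E unfolding G_def sym_def by blast

lemma side_nonpos:
  assumes "x \<in> side i" shows "x \<in> {z. bary i z \<le> 0}" "p \<notin> {z. bary i z \<le> 0}"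
  using side_subset(2,3)[OF assms] p_pos[of i] by auto

lemma p_notin_G:
  assumes "(x, y) \<in> G" shows "p \<notin> closed_segment x y"
proof (cases "(x, y) \<in> E")
  case True
  then show ?thesis by (rule p_notin)
next
  case False
  then obtain i where "x \<in> side i" "y \<in> side i"
    using assms unfolding G_def by blast
  then have "closed_segment x y \<subseteq> {z. bary i z \<le> 0}" "p \<notin> {z. bary i z \<le> 0}"
    using side_nonpos convex_bary_nonpos by (metis closed_segment_subset)+
  then show ?thesis by blast
qed

lemma crossing_path:
  assumes "(x, y) \<in> G" "x \<noteq> y"
  shows "arc (crossing_path x y)" "pathstart (crossing_path x y) = x" "pathfinish (crossing_path x y) = y"
    "p \<notin> path_image (crossing_path x y)"
    "Re (winding_number (crossing_path x y) p) = angle_turn p x y"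
    "(\<exists>i. x \<in> side i \<and> y \<in> side i \<and> path_image (crossing_path x y)
        \<subseteq> {x, y} \<union> {z. bary i z < 0 \<and> (\<forall>j<3. j \<noteq> i \<longrightarrow> 0 < bary j z)})
     \<or> ((x, y) \<in> E \<and> path_image (crossing_path x y) = closed_segment x y)"
proof -
  define i where "i = (SOME i. x \<in> side i \<and> y \<in> side i)"
  have "arc (crossing_path x y) \<and> pathstart (crossing_path x y) = x \<and> pathfinish (crossing_path x y) = y \<and>
    p \<notin> path_image (crossing_path x y) \<and>
    Re (winding_number (crossing_path x y) p) = angle_turn p x y \<and>
    ((\<exists>i. x \<in> side i \<and> y \<in> side i \<and> path_image (crossing_path x y)
        \<subseteq> {x, y} \<union> {z. bary i z < 0 \<and> (\<forall>j<3. j \<noteq> i \<longrightarrow> 0 < bary j z)})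
     \<or> ((x, y) \<in> E \<and> path_image (crossing_path x y) = closed_segment x y))"
  proof (cases "\<exists>i. x \<in> side i \<and> y \<in> side i")
    case True
    then have xy: "x \<in> side i" "y \<in> side i"
      using someI_ex[OF True] unfolding i_def by auto
    then interpret chord i x y using chord_side assms(2) by blast
    have c: "crossing_path x y = bulge i x y"
      unfolding crossing_path_def i_def using True by simp
    have "path_image (bulge i x y) \<subseteq> {x, y} \<union> {z. bary i z < 0 \<and> (\<forall>j<3. j \<noteq> i \<longrightarrow> 0 < bary j z)}"
      using bulge_outside by blast
    moreover have "0 < bary i p" using p_pos side_subset(2)[OF xy(1)] by blast
    moreover have "pathstart (bulge i x y) = x" "pathfinish (bulge i x y) = y"
      by (simp_all add: bulge_def)
    ultimately show ?thesis
      unfolding c using arc_bulge bulge_winding xy by blast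
  next
    case False
    then have "(x, y) \<in> E" using assms(1) unfolding G_def by blast
    moreover have "crossing_path x y = linepath x y"
      unfolding crossing_path_def by (rule if_not_P[OF False])
    ultimately show ?thesis using assms(2) p_notin by (simp add: angle_turn_def)
  qed
  then show "arc (crossing_path x y)" "pathstart (crossing_path x y) = x" "pathfinish (crossing_path x y) = y"
    "p \<notin> path_image (crossing_path x y)"
    "Re (winding_number (crossing_path x y) p) = angle_turn p x y"
    "(\<exists>i. x \<in> side i \<and> y \<in> side i \<and> path_image (crossing_path x y)
        \<subseteq> {x, y} \<union> {z. bary i z < 0 \<and> (\<forall>j<3. j \<noteq> i \<longrightarrow> 0 < bary j z)})
     \<or> ((x, y) \<in> E \<and> path_image (crossing_path x y) = closed_segment x y)" by blast+
qed

lemma edge_nonneg: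
  assumes "(x, y) \<in> E" "z \<in> closed_segment x y" "i < 3"
  shows "0 \<le> bary i z"
proof -
  have "x \<in> {z. 0 \<le> bary i z}" "y \<in> {z. 0 \<le> bary i z}"
    using assms E_V nonneg by auto
  then have "closed_segment x y \<subseteq> {z. 0 \<le> bary i z}"
    using convex_bary_nonneg by (intro closed_segment_subset) auto
  then show ?thesis using assms(2) by blast
qed

text \<open>By \<open>not_same\<close>, two bulges lie beyond different sides, where the signs of
  the coordinates are incompatible. A bulge meets the triangle only in its end points, and these are
  vertices, which lie on an edge only as its ends. Two edges are covered by
  \<open>edge_int\<close>.\<close>

lemma crossing_path_int:
  assumes G: "(x, y) \<in> G" "(x', y') \<in> G" "x \<noteq> y" "x' \<noteq> y'" "{x, y} \<noteq> {x', y'}"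
    and not_same: "\<And>i. \<not> ({x, y} \<subseteq> side i \<and> {x', y'} \<subseteq> side i)"
  shows "path_image (crossing_path x y) \<inter> path_image (crossing_path x' y') \<subseteq> {x, y} \<inter> {x', y'}"
proof -
  \<comment> \<open>Stated for fresh variables, so that it serves with the bulge in either
    position.\<close>
  have mixed: "path_image (crossing_path x y) \<inter> closed_segment x' y' \<subseteq> {x, y} \<inter> {x', y'}"
    if "x \<in> side i" "y \<in> side i" "(x', y') \<in> E"
      "path_image (crossing_path x y) \<subseteq> {x, y} \<union> {z. bary i z < 0 \<and> (\<forall>j<3. j \<noteq> i \<longrightarrow> 0 < bary j z)}"
    for x y x' y' i
  proof
    fix z assume z: "z \<in> path_image (crossing_path x y) \<inter> closed_segment x' y'"
    have "0 \<le> bary i z" using edge_nonneg[OF that(3), of z i] z side_subset(2)[OF that(1)] by blast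
    then have "z \<in> {x, y}" using that(4) z by force
    moreover have "z \<in> {x', y'}"
      using vertex_on_edge[OF that(3)] z calculation that(1,2) side_subset(1) by blast
    ultimately show "z \<in> {x, y} \<inter> {x', y'}" by blast
  qed
  from crossing_path(6)[OF G(1,3)] show ?thesis
  proof
    assume "\<exists>i. x \<in> side i \<and> y \<in> side i \<and> path_image (crossing_path x y)
        \<subseteq> {x, y} \<union> {z. bary i z < 0 \<and> (\<forall>j<3. j \<noteq> i \<longrightarrow> 0 < bary j z)}"
    then obtain i where i: "x \<in> side i" "y \<in> side i" "path_image (crossing_path x y)
        \<subseteq> {x, y} \<union> {z. bary i z < 0 \<and> (\<forall>j<3. j \<noteq> i \<longrightarrow> 0 < bary j z)}" by blast
    from crossing_path(6)[OF G(2,4)] show ?thesis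
    proof
      assume "\<exists>i. x' \<in> side i \<and> y' \<in> side i \<and> path_image (crossing_path x' y')
        \<subseteq> {x', y'} \<union> {z. bary i z < 0 \<and> (\<forall>j<3. j \<noteq> i \<longrightarrow> 0 < bary j z)}"
      then obtain i' where i': "x' \<in> side i'" "y' \<in> side i'" "path_image (crossing_path x' y')
        \<subseteq> {x', y'} \<union> {z. bary i' z < 0 \<and> (\<forall>j<3. j \<noteq> i' \<longrightarrow> 0 < bary j z)}" by blast
      have "i \<noteq> i'" using not_same[of i] i i' by auto
      have lt: "i < 3" "i' < 3" using i i' side_subset(2) by blast+
      have "\<forall>z \<in> {x, y, x', y'}. 0 \<le> bary i z \<and> 0 \<le> bary i' z"
        using i i' side_subset(1) nonneg lt by blast
      then show ?thesis
        using i(3) i'(3) \<open>i \<noteq> i'\<close> lt by (force dest: subsetD)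
    next
      assume "(x', y') \<in> E \<and> path_image (crossing_path x' y') = closed_segment x' y'"
      then show ?thesis using mixed[OF i(1,2) _ i(3)] by simp
    qed
  next
    assume xy: "(x, y) \<in> E \<and> path_image (crossing_path x y) = closed_segment x y"
    from crossing_path(6)[OF G(2,4)] show ?thesis
    proof
      assume "\<exists>i. x' \<in> side i \<and> y' \<in> side i \<and> path_image (crossing_path x' y')
        \<subseteq> {x', y'} \<union> {z. bary i z < 0 \<and> (\<forall>j<3. j \<noteq> i \<longrightarrow> 0 < bary j z)}"
      then show ?thesis using mixed[of x' _ y' x y] xy by blast
    next
      assume "(x', y') \<in> E \<and> path_image (crossing_path x' y') = closed_segment x' y'"
      then show ?thesis using edge_int[of x y x' y'] xy G(5) by simp
    qed
  qed
qed

text \<open>With at least three vertices there are at least three steps, and the winding number is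
  at most 1. For one or two vertices the offsets cancel.\<close>

lemma simple_walk_weight_nonneg:
  assumes "xs \<noteq> []" "distinct xs" and st: "steps (xs @ [hd xs]) \<subseteq> G"
    and not_same: "\<And>i e e'. \<lbrakk>e \<in> steps (xs @ [hd xs]); e' \<in> steps (xs @ [hd xs]); e \<noteq> e'\<rbrakk>
          \<Longrightarrow> \<not> (e \<in> side i \<times> side i \<and> e' \<in> side i \<times> side i)"
  shows "0 \<le> walk_weight (\<lambda>x y. 1 - 3 * turn_offset p x y) (xs @ [hd xs])"
proof -
  consider x where "xs = [x]" | x y where "xs = [x, y]" | "3 \<le> length xs"
  proof (cases "length xs < 3")
    case True
    \<comment> \<open>\<open>remdups_adj.cases\<close> serves only to split off lists with no, one,
      and at least two elements.\<close>
    with assms(1) show ?thesis using that by (cases xs rule: remdups_adj.cases) (auto simp: Suc_le_eq)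
  qed (use that in simp)
  then show ?thesis
  proof cases
    case 1
    then have "p \<noteq> x" using st p_notin_G[of x x] by auto
    then show ?thesis using 1 by (simp add: turn_offset_refl)
  next
    case 2
    then have "p \<notin> closed_segment x y" using st p_notin_G[of x y] by auto
    then show ?thesis using 2 by (simp add: turn_offset_commute)
  next
    case 3
    define h where "h = hd xs"
    let ?w = "xs @ [h]"
    have ne: "x \<noteq> y" if "(x, y) \<in> steps ?w" for x y
    proof -
      obtain i where i: "x = ?w ! i" "y = ?w ! Suc i" "Suc i < length ?w"
        using \<open>(x, y) \<in> steps ?w\<close> unfolding steps_nth by blast
      show ?thesis
      proof (cases "Suc i < length xs")
        case True
        then show ?thesis unfolding i
          using nth_eq_iff_index_eq[OF assms(2), of i "Suc i"] by (simp add: nth_append)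
      next
        case False
        then have "y = xs ! 0" "x = xs ! i" "i < length xs" "i = length xs - 1"
          unfolding i using i(3) hd_conv_nth[OF assms(1)] h_def by (auto simp: nth_append)
        then show ?thesis
          using 3 nth_eq_iff_index_eq[OF assms(2), of i 0] assms(1) by simp
      qed
    qed
    have "walk_weight (\<lambda>x y. winding_number (crossing_path x y) p) (xs @ [hd xs]) \<in> {-1, 0, 1}"
    proof (rule simple_cycle_winding_number[OF assms(2) 3])
      fix x y assume "(x, y) \<in> steps (xs @ [hd xs])"
      then show "arc (crossing_path x y) \<and> pathstart (crossing_path x y) = x \<and>
          pathfinish (crossing_path x y) = y \<and> p \<notin> path_image (crossing_path x y)"
        using crossing_path[of x y] st ne h_def by blast
    next
      fix x y x' y'
      assume e: "(x, y) \<in> steps (xs @ [hd xs])" "(x', y') \<in> steps (xs @ [hd xs])" "{x, y} \<noteq> {x', y'}"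
      then have "(x, y) \<noteq> (x', y')" by auto
      then have "\<not> ({x, y} \<subseteq> side i \<and> {x', y'} \<subseteq> side i)" for i
        using not_same[OF e(1,2), of i] by blast
      then show "path_image (crossing_path x y) \<inter> path_image (crossing_path x' y') \<subseteq> {x, y} \<inter> {x', y'}"
        using e st ne h_def by (intro crossing_path_int) blast+
    qed
    then have "Re (walk_weight (\<lambda>x y. winding_number (crossing_path x y) p) ?w) \<le> 1"
      unfolding h_def by auto
    moreover have "Re (walk_weight (\<lambda>x y. winding_number (crossing_path x y) p) ?w)
        = walk_weight (angle_turn p) ?w"
      unfolding Re_walk_weight
      by (rule walk_weight_cong) (use crossing_path(5) st ne h_def in blast)
    \<comment> \<open>The \<open>Arg\<close> terms at the two ends agree on a closed walk, so the
      total angle is the integer sum of the offsets.\<close>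
    moreover have "walk_weight (angle_turn p) ?w =
        Arg (last ?w - p) / (2 * pi) - Arg (hd ?w - p) / (2 * pi) + walk_weight (\<lambda>x y. real_of_int (turn_offset p x y)) ?w"
      by (rule walk_weight_diff) (use angle_turn_eq p_notin_G st h_def in blast, simp)
    moreover have "hd ?w = last ?w"
      using assms(1) h_def by simp
    ultimately have "walk_weight (turn_offset p) ?w \<le> 1"
      by (simp flip: of_int_walk_weight)
    then show ?thesis
      using 3 unfolding walk_weight_affine h_def by simp
  qed
qed

text \<open>The bounded quantity is the increment of the lifted function along an edge, where
  \<open>3 * turn_offset\<close> accounts for crossings of the branch cut. The second bound comes
  from the reversed edge, whose offset is negated.\<close>

lemma potential:
  obtains f :: "complex \<Rightarrow> int" where "\<And>x y. (x, y) \<in> G \<Longrightarrow> \<bar>f y - f x + 3 * turn_offset p x y\<bar> \<le> 1"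
proof -
  have "\<exists>f. \<forall>(x, y) \<in> G. f y \<le> f x + (1 - 3 * turn_offset p x y)"
  proof (rule potential_exists[OF finite_V G_V])
    fix xs assume "xs \<noteq> []" "steps xs \<subseteq> G" "hd xs = last xs"
    then show "0 \<le> walk_weight (\<lambda>x y. 1 - 3 * turn_offset p x y) xs"
    proof (rule closed_walk_weight_nonneg[where S = side and E = G, rotated -3])
      fix i show "side i \<times> side i \<subseteq> G" unfolding G_def by blast
    next
      fix i u w u' w' assume "u \<in> side i" "w \<in> side i" "u' \<in> side i" "w' \<in> side i"
      then show "1 - 3 * turn_offset p u w + (1 - 3 * turn_offset p u' w')
          = 1 - 3 * turn_offset p u w' + (1 - 3 * turn_offset p u' w)"
        using turn_offset_exchange[OF convex_bary_nonpos, of p i u w u' w'] side_nonpos by simp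
    qed (fact simple_walk_weight_nonneg)
  qed
  then obtain f where f: "\<And>x y. (x, y) \<in> G \<Longrightarrow> f y \<le> f x + (1 - 3 * turn_offset p x y)" by blast
  have "\<bar>f y - f x + 3 * turn_offset p x y\<bar> \<le> 1" if "(x, y) \<in> G" for x y
    using f[OF that] f[OF G_sym[OF that]] turn_offset_commute[OF p_notin_G[OF that]] by simp
  then show ?thesis using that by blast
qed

text \<open>Labels are residues of \<open>f\<close> modulo 3. The increments around a three-cycle
  sum to 0 if its triangle misses \<open>p\<close>, and to 3 or -3 if \<open>p\<close> is interior.
  The last two claims apply this to chords on the sides.\<close>

lemma labelling:
  obtains l :: "complex \<Rightarrow> nat" where
    "\<And>z. l z < 3"
    "\<And>x y z. \<lbrakk>(x, y) \<in> E; (y, z) \<in> E; (z, x) \<in> E; p \<notin> convex hull {x, y, z}\<rbrakk> \<Longrightarrow> \<not> inj_on l {x, y, z}"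
    "\<And>x y z. \<lbrakk>(x, y) \<in> E; (y, z) \<in> E; (z, x) \<in> E; p \<in> interior (convex hull {x, y, z})\<rbrakk> \<Longrightarrow> inj_on l {x, y, z}"
    "inj_on l {corner 0, corner 1, corner 2}"
    "\<And>i z. i < 3 \<Longrightarrow> z \<in> V \<Longrightarrow> bary i z = 0 \<Longrightarrow> \<exists>j<3. j \<noteq> i \<and> l z = l (corner j)"
proof -
  obtain f where f: "\<And>x y. (x, y) \<in> G \<Longrightarrow> \<bar>f y - f x + 3 * turn_offset p x y\<bar> \<le> 1"
    using potential by blast
  define l where "l z = nat (f z mod 3)" for z
  have less: "l z < 3" for z unfolding l_def by (simp add: nat_less_iff)
  have leq: "l x = l y \<longleftrightarrow> 3 dvd (f y - f x + 3 * turn_offset p x y)" for x y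
  proof -
    have "l x = l y \<longleftrightarrow> f x mod 3 = f y mod 3" unfolding l_def by (simp add: eq_nat_nat_iff)
    also have "\<dots> \<longleftrightarrow> 3 dvd (f y - f x)" by (metis mod_eq_dvd_iff)
    also have "\<dots> \<longleftrightarrow> 3 dvd (f y - f x + 3 * turn_offset p x y)"
      by (simp add: dvd_add_left_iff)
    finally show ?thesis .
  qed
  \<comment> \<open>Increments lie between -1 and 1, where 0 is the only multiple of 3.\<close>
  have leq0: "l x = l y \<longleftrightarrow> f y - f x + 3 * turn_offset p x y = 0" if "(x, y) \<in> G" for x y
    unfolding leq using f[OF that] by presburger
  have two: "\<not> (l x \<noteq> l y \<and> l y \<noteq> l z \<and> l z \<noteq> l x)"
    if G: "(x, y) \<in> G" "(y, z) \<in> G" "(z, x) \<in> G"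
      and C: "convex C" "p \<notin> C" "x \<in> C" "y \<in> C" "z \<in> C" for x y z C
  proof -
    \<comment> \<open>Parity: three numbers from {-1, 1} have an odd sum.\<close>
    have arith: "\<not> (a \<noteq> 0 \<and> b \<noteq> 0 \<and> c \<noteq> 0)"
      if "\<bar>a\<bar> \<le> 1" "\<bar>b\<bar> \<le> 1" "\<bar>c\<bar> \<le> 1" "a + b + c = 0" for a b c :: int
      using that by linarith
    show ?thesis
      unfolding leq0[OF G(1)] leq0[OF G(2)] leq0[OF G(3)]
      by (rule arith) (use f G turn_offset_convex[OF C] in auto)
  qed
  have three: "l x \<noteq> l y \<and> l y \<noteq> l z \<and> l z \<noteq> l x"
    if G: "(x, y) \<in> G" "(y, z) \<in> G" "(z, x) \<in> G" and p: "p \<in> interior (convex hull {x, y, z})" for x y z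
  proof -
    have arith: "a \<noteq> 0 \<and> b \<noteq> 0 \<and> c \<noteq> 0"
      if "\<bar>a\<bar> \<le> 1" "\<bar>b\<bar> \<le> 1" "\<bar>c\<bar> \<le> 1" "\<bar>k\<bar> = 1" "a + b + c = 3 * k" for a b c k :: int
      using that by linarith
    show ?thesis
      unfolding leq0[OF G(1)] leq0[OF G(2)] leq0[OF G(3)]
      by (rule arith[OF f[OF G(1)] f[OF G(2)] f[OF G(3)] turn_offset_interior[OF p]]) simp
  qed
  have side_corner: "corner j \<in> side i" if "i < 3" "j < 3" "i \<noteq> j" for i j
    using that corner_V bary_corner unfolding side_def by simp
  have side_G: "(x, y) \<in> G" if "x \<in> side i" "y \<in> side i" for x y i
    using that unfolding G_def by blast
  \<comment> \<open>Two corners always share a side, so they are joined in \<open>G\<close> even if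
    not in \<open>E\<close>.\<close>
  have cG: "(corner 0, corner 1) \<in> G" "(corner 1, corner 2) \<in> G" "(corner 2, corner 0) \<in> G"
    by (rule side_G[of _ 2] side_G[of _ 0] side_G[of _ 1]; rule side_corner; simp)+
  have corners: "l (corner 0) \<noteq> l (corner 1) \<and> l (corner 1) \<noteq> l (corner 2) \<and> l (corner 2) \<noteq> l (corner 0)"
    using three[OF cG] interior_corner_triangle p_pos by blast
  show thesis
  proof (rule that[of l])
    show "l z < 3" for z by (rule less)
  next
    fix x y z
    assume E: "(x, y) \<in> E" "(y, z) \<in> E" "(z, x) \<in> E" and p: "p \<notin> convex hull {x, y, z}"
    have "\<not> (l x \<noteq> l y \<and> l y \<noteq> l z \<and> l z \<noteq> l x)"
      by (rule two[where C = "convex hull {x, y, z}"]) (use E p in \<open>auto simp: G_def hull_inc\<close>)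
    then show "\<not> inj_on l {x, y, z}"
      using irrefl_E E unfolding inj_on_def by blast
  next
    fix x y z
    assume E: "(x, y) \<in> E" "(y, z) \<in> E" "(z, x) \<in> E" and p: "p \<in> interior (convex hull {x, y, z})"
    have "l x \<noteq> l y \<and> l y \<noteq> l z \<and> l z \<noteq> l x"
      by (rule three) (use E p in \<open>auto simp: G_def\<close>)
    then show "inj_on l {x, y, z}"
      unfolding inj_on_def by auto
  next
    show "inj_on l {corner 0, corner 1, corner 2}"
      using corners unfolding inj_on_def by auto
  next
    fix i z assume i: "i < (3::nat)" and z: "z \<in> V" "bary i z = 0"
    then have zs: "z \<in> side i" by (simp add: side_def)
    obtain j k where jk: "j < 3" "k < 3" "j \<noteq> i" "k \<noteq> i" "j \<noteq> k"
      and neq: "l (corner j) \<noteq> l (corner k)"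
    proof -
      consider "i = 0" | "i = 1" | "i = 2" using i by linarith
      then show ?thesis using that[of 1 2] that[of 0 2] that[of 0 1] corners by cases auto
    qed
    have cs: "corner j \<in> side i" "corner k \<in> side i" using side_corner i jk by auto
    \<comment> \<open>\<open>z\<close> and the two corners of its side lie in a half plane missing
      \<open>p\<close>. Two of the three labels therefore agree, and those of the corners
      differ.\<close>
    have "\<not> (l z \<noteq> l (corner j) \<and> l (corner j) \<noteq> l (corner k) \<and> l (corner k) \<noteq> l z)"
      by (rule two[OF _ _ _ convex_bary_nonpos]) (use side_G side_nonpos zs cs in blast)+
    then show "\<exists>j<3. j \<noteq> i \<and> l z = l (corner j)"
      using neq jk by metis
  qed
qed

end

subsection \<open>Transfer to a triangle in a Euclidean space\<close>

text \<open>Translate \<open>v 1\<close> to the origin and extend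
  \<open>v 2 - v 1 \<mapsto> 1\<close>, \<open>v 3 - v 1 \<mapsto> \<i>\<close> linearly to the
  whole space. Hulls, and relative interiors of convex sets, pass through any linear map;
  injectivity is claimed on the plane of the triangle.\<close>

lemma affine_coordinates:
  fixes v :: "nat \<Rightarrow> 'a::euclidean_space"
  assumes "spans_simplex 2 v"
  obtains \<phi> :: "'a \<Rightarrow> complex" where
    "\<And>S. \<phi> ` (convex hull S) = convex hull (\<phi> ` S)"
    "\<And>S. \<phi> ` (affine hull S) = affine hull (\<phi> ` S)"
    "\<And>S. convex S \<Longrightarrow> \<phi> ` rel_interior S = rel_interior (\<phi> ` S)"
    "\<And>i. i < 3 \<Longrightarrow> \<phi> (v (Suc i)) = corner i"
    "inj_on \<phi> (affine hull (v ` {1..2+1}))"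
proof -
  have I: "{1..2+1} = {1, 2, 3::nat}" by auto
  have inj: "v 1 \<noteq> v 2" "v 1 \<noteq> v 3" "v 2 \<noteq> v 3"
    and ind: "\<not> affine_dependent {v 1, v 2, v 3}"
    using assms unfolding spans_simplex_def I by auto
  have "v 1 \<notin> {v 2, v 3}" using inj by simp
  from affine_dependent_iff_dependent[OF this] ind
  have ind': "\<not> dependent ((\<lambda>x. - v 1 + x) ` {v 2, v 3})" by blast
  obtain g :: "'a \<Rightarrow> complex" where g: "linear g"
    and g': "\<forall>x \<in> (\<lambda>x. - v 1 + x) ` {v 2, v 3}. g x = (if x = - v 1 + v 2 then 1 else \<i>)"
    using linear_independent_extend[OF ind', of "\<lambda>x. if x = - v 1 + v 2 then 1 else \<i>"] by blast
  interpret linear g by fact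
  define \<phi> where "\<phi> = g \<circ> (\<lambda>x. - v 1 + x)"
  have \<phi>: "\<phi> ` S = g ` ((\<lambda>x. - v 1 + x) ` S)" for S
    unfolding \<phi>_def by (simp add: image_comp)
  have corner: "\<phi> (v 1) = 0" "\<phi> (v 2) = 1" "\<phi> (v 3) = \<i>"
    using g' inj by (auto simp: \<phi>_def zero)
  \<comment> \<open>On that plane the coefficients \<open>b\<close> and \<open>c\<close> can be read
    off the image, which gives injectivity.\<close>
  have comb: "\<phi> (a *\<^sub>R v 1 + b *\<^sub>R v 2 + c *\<^sub>R v 3) = Complex b c" if "a + b + c = 1" for a b c
  proof -
    have "- v 1 + (a *\<^sub>R v 1 + b *\<^sub>R v 2 + c *\<^sub>R v 3)
        = (a + b + c - 1) *\<^sub>R v 1 + b *\<^sub>R (- v 1 + v 2) + c *\<^sub>R (- v 1 + v 3)"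
      by (simp add: algebra_simps)
    then have "\<phi> (a *\<^sub>R v 1 + b *\<^sub>R v 2 + c *\<^sub>R v 3) = b *\<^sub>R \<phi> (v 2) + c *\<^sub>R \<phi> (v 3)"
      using that by (simp only: \<phi>_def o_apply add scale) simp
    then show ?thesis unfolding corner by (simp add: complex_eq_iff)
  qed
  show thesis
  proof (rule that[of \<phi>])
    fix S
    show "\<phi> ` (convex hull S) = convex hull (\<phi> ` S)"
      unfolding \<phi> convex_hull_linear_image[OF g, symmetric] convex_hull_translation ..
    show "\<phi> ` (affine hull S) = affine hull (\<phi> ` S)"
      unfolding \<phi> affine_hull_linear_image[OF g[unfolded linear_conv_bounded_linear], symmetric]
        affine_hull_translation ..
    show "\<phi> ` rel_interior S = rel_interior (\<phi> ` S)" if "convex S"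
      unfolding \<phi> rel_interior_convex_linear_image[OF g convex_translation[OF that], symmetric]
        rel_interior_translation ..
  next
    fix i :: nat assume "i < 3"
    then consider "i = 0" | "i = 1" | "i = 2" by linarith
    then show "\<phi> (v (Suc i)) = corner i"
      using corner by cases (auto simp: corner_def numeral_2_eq_2 numeral_3_eq_3)
  next
    show "inj_on \<phi> (affine hull (v ` {1..2+1}))"
    proof (rule inj_onI)
      fix x y
      assume xy: "x \<in> affine hull (v ` {1..2+1})" "y \<in> affine hull (v ` {1..2+1})" "\<phi> x = \<phi> y"
      have eq: "v ` {1..2+1} = {v 1, v 2, v 3}" unfolding I by simp
      obtain a b c where x: "x = a *\<^sub>R v 1 + b *\<^sub>R v 2 + c *\<^sub>R v 3" "a + b + c = 1"
        using xy(1) unfolding eq affine_hull_3 by blast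
      obtain a' b' c' where y: "y = a' *\<^sub>R v 1 + b' *\<^sub>R v 2 + c' *\<^sub>R v 3" "a' + b' + c' = 1"
        using xy(2) unfolding eq affine_hull_3 by blast
      have "b = b' \<and> c = c'" using xy(3) unfolding x(1) y(1) comb[OF x(2)] comb[OF y(2)] by simp
      moreover from this have "a = a'" using x(2) y(2) by simp
      ultimately show "x = y" unfolding x(1) y(1) by simp
    qed
  qed
qed

lemma affine_hull_corners: "affine hull {corner 0, corner 1, corner 2} = UNIV"
proof -
  have "z \<in> affine hull {corner 0, corner 1, corner 2}" for z
  proof -
    have "z = (1 - Re z - Im z) *\<^sub>R corner 0 + Re z *\<^sub>R corner 1 + Im z *\<^sub>R corner 2"
      by (auto simp: corner_def intro: complex_eqI)
    then show ?thesis unfolding affine_hull_3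
      by (intro CollectI exI[of _ "1 - Re z - Im z"] exI[of _ "Re z"] exI[of _ "Im z"]) auto
  qed
  then show ?thesis by blast
qed

lemma corner_triangle_nonneg:
  assumes "i < 3" shows "convex hull {corner 0, corner 1, corner 2} \<subseteq> {z. 0 \<le> bary i z}"
  using assms by (intro hull_minimal convex_bary_nonneg) (auto simp: bary_corner)

text \<open>Each coordinate condition is rewritten as an inner product, because the interior of a
  closed half space is known in that form.\<close>

lemma interior_corner_triangle_pos:
  assumes "p \<in> interior (convex hull {corner 0, corner 1, corner 2})" "i < 3"
  shows "0 < bary i p"
proof -
  have *: "p \<in> interior {z. 0 \<le> bary i z}"
    using assms interior_mono corner_triangle_nonneg by blast
  have half: "{z. 0 \<le> bary 0 z} = {z. (- 1 - \<i>) \<bullet> z \<ge> - 1}" "{z. 0 \<le> bary 1 z} = {z. 1 \<bullet> z \<ge> 0}"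
    "{z. 0 \<le> bary 2 z} = {z. \<i> \<bullet> z \<ge> 0}"
    by (auto simp: bary_def inner_complex_def)
  have ne: "(- 1 - \<i>) \<noteq> 0" by (simp add: complex_eq_iff)
  from assms(2) consider "i = 0" | "i = 1" | "i = 2" by linarith
  then show ?thesis
  proof cases
    case 1
    have "(- 1 - \<i>) \<bullet> p > - 1"
      using * interior_halfspace_ge[OF ne, of "- 1"] unfolding 1 half by blast
    then show ?thesis by (simp add: 1 bary_def inner_complex_def)
  next
    case 2
    have "1 \<bullet> p > (0::real)"
      using * interior_halfspace_ge[of "1::complex" 0] unfolding 2 half by auto
    then show ?thesis by (simp add: 2 bary_def inner_complex_def)
  next
    case 3
    have "\<i> \<bullet> p > 0"
      using * interior_halfspace_ge[of \<i> 0] unfolding 3 half by auto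
    then show ?thesis by (simp add: 3 bary_def inner_complex_def)
  qed
qed

theorem theorem1p3:
  fixes v :: "nat \<Rightarrow> 'a::euclidean_space"
    and K :: "'a set set"
    and \<sigma> :: "'a set"
  assumes "spans_simplex 2 v"
    and "triangulates K (std_simplex 2 v)"
    and "\<sigma> \<in> complex_facets 2 K"
  shows "\<exists>l. sperner_labelling 2 v K l \<and>
             rainbow l \<sigma> \<and>
             (\<forall>\<tau> \<in> complex_facets 2 K. rainbow l \<tau> \<longrightarrow> \<tau> = \<sigma>)"
proof -

  \<comment> \<open>Affine coordinates\<close>
  obtain \<phi> :: "'a \<Rightarrow> complex" where
    hull: "\<And>S. \<phi> ` (convex hull S) = convex hull (\<phi> ` S)"
    and aff: "\<And>S. \<phi> ` (affine hull S) = affine hull (\<phi> ` S)"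
    and rel: "\<And>S. convex S \<Longrightarrow> \<phi> ` rel_interior S = rel_interior (\<phi> ` S)"
    and \<phi>v: "\<And>i. i < 3 \<Longrightarrow> \<phi> (v (Suc i)) = corner i"
    and inj_aff: "inj_on \<phi> (affine hull (v ` {1..2+1}))"
    using affine_coordinates[OF assms(1)] by blast
  let ?D = "std_simplex 2 v"
  have inj: "inj_on \<phi> ?D"
    using inj_aff convex_hull_subset_affine_hull unfolding std_simplex_def by (rule inj_on_subset)
  have I: "{1..2+1} = {Suc 0, Suc 1, Suc 2}" by auto
  have img: "\<phi> ` v ` {1..2+1} = {corner 0, corner 1, corner 2}"
    unfolding I image_insert image_empty \<phi>v[OF less_3_iff[THEN iffD2, OF disjI1[OF refl]]]
    using \<phi>v[of 0] \<phi>v[of 1] \<phi>v[of 2] by simp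
  have imgD: "\<phi> ` ?D = convex hull {corner 0, corner 1, corner 2}"
    unfolding std_simplex_def hull img ..

  \<comment> \<open>A point in the interior of the chosen facet\<close>
  have K: "finite K" "\<And>F S. S \<in> K \<Longrightarrow> F face_of S \<Longrightarrow> F \<in> K"
    "\<And>S S'. S \<in> K \<Longrightarrow> S' \<in> K \<Longrightarrow> S \<inter> S' face_of S"
    and KD: "\<Union>K = ?D"
    using assms(2) unfolding triangulates_def simplicial_complex_def by auto
  have sub: "S \<subseteq> ?D" if "S \<in> K" for S using that KD by blast
  have facet: "\<exists>C. \<not> affine_dependent C \<and> card C = 3 \<and> \<tau> = convex hull C \<and> simplex_vertices \<tau> = C \<and>
      aff_dim \<tau> = 2"
    if "\<tau> \<in> complex_facets 2 K" for \<tau>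
  proof -
    have "int 2 simplex \<tau>" using that unfolding complex_facets_def by blast
    then obtain C where C: "\<not> affine_dependent C" "int (card C) = int 2 + 1" "\<tau> = convex hull C"
      unfolding simplex_def by blast
    from C(2) have "card C = 3" by linarith
    note C = C(1) this C(3)
    have "aff_dim \<tau> = 2"
      using C aff_dim_affine_independent[OF C(1)] by (simp add: aff_dim_convex_hull)
    moreover have "simplex_vertices \<tau> = C"
      using C extreme_point_of_convex_hull_affine_independent unfolding simplex_vertices_def by blast
    ultimately show ?thesis using C by blast
  qed
  obtain C where C: "\<not> affine_dependent C" "card C = 3" "\<sigma> = convex hull C" "aff_dim \<sigma> = 2"
    using facet[OF assms(3)] by blast
  have \<sigma>K: "\<sigma> \<in> K" using assms(3) unfolding complex_facets_def by blast
  have "\<sigma> \<noteq> {}" "convex \<sigma>" using C(4) C(3) by auto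
  then obtain p0 where p0: "p0 \<in> rel_interior \<sigma>"
    using rel_interior_eq_empty by blast
  then have p0\<sigma>: "p0 \<in> \<sigma>" using rel_interior_subset by blast
  \<comment> \<open>\<open>\<sigma> \<inter> S\<close> is a face of \<sigma> that meets its relative
    interior, hence all of \<sigma>. So \<sigma> is a face of \<open>S\<close>, and a proper face
    would have smaller dimension.\<close>
  have only_\<sigma>: "S = \<sigma>" if S: "S \<in> K" "p0 \<in> S" "convex S" "aff_dim S \<le> 2" for S
  proof -
    have "\<sigma> \<inter> S = \<sigma>"
      using face_of_disjoint_rel_interior[OF K(3)[OF \<sigma>K S(1)]] p0 p0\<sigma> S(2) by blast
    then have "\<sigma> face_of S" using K(3)[OF S(1) \<sigma>K] by (simp add: Int_commute)
    then show ?thesis using face_of_aff_dim_lt[OF S(3)] S(4) C(4) by force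
  qed

  define p where "p = \<phi> p0"
  have p_avoids: "p \<notin> \<phi> ` S" if "S \<in> K" "convex S" "aff_dim S \<le> 2" "S \<noteq> \<sigma>" for S
  proof
    assume "p \<in> \<phi> ` S"
    then have "p0 \<in> S"
      unfolding p_def using inj_on_image_mem_iff[OF inj] sub[OF that(1)] sub[OF \<sigma>K] p0\<sigma> by blast
    then show False using only_\<sigma> that by blast
  qed
  have p_int: "p \<in> interior (\<phi> ` \<sigma>)"
  proof -
    \<comment> \<open>\<sigma> spans the plane of the big triangle, so its image spans the complex
      plane, where relative interior and interior coincide.\<close>
    have "affine hull \<sigma> = affine hull ?D"
    proof (rule ccontr)
      assume "affine hull \<sigma> \<noteq> affine hull ?D"
      then have "affine hull \<sigma> \<subset> affine hull ?D"
        using hull_mono[OF sub[OF \<sigma>K]] by blast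
      then have "aff_dim \<sigma> < aff_dim ?D" by (rule aff_dim_psubset)
      moreover have "aff_dim ?D \<le> 2"
        unfolding std_simplex_def aff_dim_convex_hull
        using aff_dim_le_card[of "v ` {1..2+1}"] card_image_le[of "{1..2+1}" v] by simp
      ultimately show False using C(4) by simp
    qed
    then have "affine hull (\<phi> ` \<sigma>) = affine hull (\<phi> ` ?D)"
      unfolding aff[symmetric] by simp
    also have "\<dots> = UNIV"
      unfolding imgD affine_hull_convex_hull by (rule affine_hull_corners)
    finally have "rel_interior (\<phi> ` \<sigma>) = interior (\<phi> ` \<sigma>)"
      by (rule rel_interior_interior)
    moreover have "p \<in> rel_interior (\<phi> ` \<sigma>)"
      using p0 rel[OF \<open>convex \<sigma>\<close>] unfolding p_def by blast
    ultimately show ?thesis by simp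
  qed

  \<comment> \<open>The drawing of the edges in the plane\<close>
  define V where "V = \<phi> ` complex_vertices K"
  define E where "E = {(\<phi> x, \<phi> y) | x y. x \<noteq> y \<and> convex hull {x, y} \<in> K}"
  have vD: "x \<in> ?D" if "x \<in> complex_vertices K" for x
    using that sub unfolding complex_vertices_def by blast
  have seg: "closed_segment (\<phi> x) (\<phi> y) = \<phi> ` (convex hull {x, y})" for x y
    unfolding segment_convex_hull hull by simp
  have seg_ends: "x \<in> complex_vertices K \<and> y \<in> complex_vertices K" if "convex hull {x, y} \<in> K" for x y
  proof -
    have "{x} face_of convex hull {x, y}" "{y} face_of convex hull {x, y}"
      unfolding face_of_singleton segment_convex_hull[symmetric] extreme_point_of_segment by auto
    then show ?thesis using K(2)[OF that] unfolding complex_vertices_def by blast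
  qed
  have seg_int: "convex hull {x, y} \<inter> convex hull {x', y'} \<subseteq> {x, y} \<inter> {x', y'}"
    if e: "convex hull {x, y} \<in> K" "convex hull {x', y'} \<in> K" and ne: "{x, y} \<noteq> {x', y'}" for x y x' y'
  proof -
    let ?I = "convex hull {x, y} \<inter> convex hull {x', y'}"
    have "?I face_of convex hull {x, y}" "?I face_of convex hull {x', y'}"
      using K(3)[OF e] K(3)[OF e(2) e(1)] by (simp_all add: Int_commute)
    \<comment> \<open>The intersection is a face of both edges, so a hull of end points of each. Its
      extreme points give \<open>c = c'\<close>; as the edges differ, at most one point is
      left.\<close>
    then obtain c c' where c: "c \<subseteq> {x, y}" "?I = convex hull c" and c': "c' \<subseteq> {x', y'}" "?I = convex hull c'"
      unfolding face_of_convex_hull_affine_independent[OF affine_independent_2] by blast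
    have ic: "\<not> affine_dependent c" "\<not> affine_dependent c'"
      using c(1) c'(1) affine_independent_2 affine_dependent_subset by blast+
    have "c = {z. z extreme_point_of ?I}"
      unfolding c(2) extreme_point_of_convex_hull_affine_independent[OF ic(1)] by simp
    also have "\<dots> = c'"
      unfolding c'(2) extreme_point_of_convex_hull_affine_independent[OF ic(2)] by simp
    finally have "c = c'" .
    then have sub: "c \<subseteq> {x, y} \<inter> {x', y'}" using c(1) c'(1) by blast
    then obtain a where "c \<subseteq> {a}" using ne by blast
    then have "convex hull c = c" by (metis convex_hull_empty convex_hull_singleton subset_singletonD)
    then show ?thesis using c(2) sub by simp
  qed

  interpret plane_drawing V E p
  proof
    have "complex_vertices K = (\<lambda>x. {x}) -` K" unfolding complex_vertices_def by auto
    then have "finite (complex_vertices K)" using K(1) by (simp add: finite_vimageI)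
    then show "finite V" unfolding V_def by simp
  next
    fix i z assume "i < (3::nat)" "z \<in> V"
    then show "0 \<le> bary i z"
      using vD imgD corner_triangle_nonneg[of i] unfolding V_def by blast
  next
    fix i assume i: "i < (3::nat)"
    then have "v (Suc i) \<in> complex_vertices K"
      by (intro triangulates_vertices[OF assms(1,2)]) auto
    then show "corner i \<in> V" unfolding V_def using \<phi>v[OF i] by (metis imageI)
  next
    show "E \<subseteq> V \<times> V" unfolding E_def V_def using seg_ends by blast
  next
    show "sym E" unfolding E_def sym_def by (auto simp: insert_commute) (metis insert_commute)
  next
    fix a b assume "(a, b) \<in> E"
    then show "a \<noteq> b" unfolding E_def using inj_onD[OF inj] seg_ends vD by blast
  next
    fix i assume "i < (3::nat)"
    then show "0 < bary i p"
      using p_int interior_corner_triangle_pos[of p i] interior_mono[OF image_mono[OF sub[OF \<sigma>K], of \<phi>]]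
      unfolding imgD by blast
  next
    fix a b assume "(a, b) \<in> E"
    then obtain x y where xy: "a = \<phi> x" "b = \<phi> y" "convex hull {x, y} \<in> K" unfolding E_def by blast
    have "aff_dim (convex hull {x, y}) \<le> 1"
      by (simp add: aff_dim_convex_hull aff_dim_2)
    moreover from this have "convex hull {x, y} \<noteq> \<sigma>" using C(4) by auto
    ultimately show "p \<notin> closed_segment a b"
      unfolding xy(1,2) seg by (intro p_avoids[OF xy(3)]) auto
  next
    fix a b z assume "(a, b) \<in> E" "z \<in> V" "z \<in> closed_segment a b"
    then obtain x y w where xy: "a = \<phi> x" "b = \<phi> y" "convex hull {x, y} \<in> K"
      and w: "z = \<phi> w" "w \<in> complex_vertices K" "\<phi> w \<in> \<phi> ` (convex hull {x, y})"
      unfolding E_def V_def by (auto simp: seg)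
    have "w \<in> convex hull {x, y}"
      using inj_on_image_mem_iff[OF inj vD[OF w(2)] sub[OF xy(3)]] w(3) by blast
    moreover have "{w} \<in> K" using w(2) unfolding complex_vertices_def by blast
    \<comment> \<open>A vertex of the complex on an edge meets it in a face, and is therefore an end
      point.\<close>
    ultimately have "{w} face_of convex hull {x, y}"
      using K(3)[OF xy(3), of "{w}"] by (simp add: Int_absorb1)
    then have "w \<in> {x, y}"
      unfolding face_of_singleton segment_convex_hull[symmetric] extreme_point_of_segment by auto
    then show "z \<in> {a, b}" using xy w by auto
  next
    fix a b a' b' assume E: "(a, b) \<in> E" "(a', b') \<in> E" "{a, b} \<noteq> {a', b'}"
    obtain x y where xy: "a = \<phi> x" "b = \<phi> y" "convex hull {x, y} \<in> K"
      using E(1) unfolding E_def by blast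
    obtain x' y' where xy': "a' = \<phi> x'" "b' = \<phi> y'" "convex hull {x', y'} \<in> K"
      using E(2) unfolding E_def by blast
    have "{x, y} \<noteq> {x', y'}" using E(3) xy xy' by (metis image_empty image_insert)
    then have "\<phi> ` (convex hull {x, y} \<inter> convex hull {x', y'}) \<subseteq> \<phi> ` ({x, y} \<inter> {x', y'})"
      using seg_int[OF xy(3) xy'(3)] by blast
    then show "closed_segment a b \<inter> closed_segment a' b' \<subseteq> {a, b} \<inter> {a', b'}"
      unfolding xy(1,2) xy'(1,2) seg
      unfolding inj_on_image_Int[OF inj sub[OF xy(3)] sub[OF xy'(3)], symmetric] by blast
  qed

  \<comment> \<open>The labelling and its rainbow facets\<close>
  obtain l where l: "\<And>z. l z < (3::nat)"
    "\<And>x y z. \<lbrakk>(x, y) \<in> E; (y, z) \<in> E; (z, x) \<in> E; p \<notin> convex hull {x, y, z}\<rbrakk> \<Longrightarrow> \<not> inj_on l {x, y, z}"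
    "\<And>x y z. \<lbrakk>(x, y) \<in> E; (y, z) \<in> E; (z, x) \<in> E; p \<in> interior (convex hull {x, y, z})\<rbrakk> \<Longrightarrow> inj_on l {x, y, z}"
    "inj_on l {corner 0, corner 1, corner 2}"
    "\<And>i z. i < 3 \<Longrightarrow> z \<in> V \<Longrightarrow> bary i z = 0 \<Longrightarrow> \<exists>j<3. j \<noteq> i \<and> l z = l (corner j)"
    using labelling by blast

  \<comment> \<open>The corners carry the three labels in an unknown order; \<pi> renames them so
    that \<open>corner i\<close> gets \<open>Suc i\<close>, matching the numbering of
    \<open>v\<close> from 1.\<close>
  define \<pi> :: "nat \<Rightarrow> nat" where
    "\<pi> n = (if n = l (corner 0) then 1 else if n = l (corner 1) then 2 else 3)" for n
  have cor: "l (corner 0) \<noteq> l (corner 1)" "l (corner 0) \<noteq> l (corner 2)" "l (corner 1) \<noteq> l (corner 2)"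
  proof -
    have "corner 0 \<noteq> corner 1" "corner 0 \<noteq> corner 2" "corner 1 \<noteq> corner 2"
      by (simp_all add: corner_def complex_eq_iff)
    then show "l (corner 0) \<noteq> l (corner 1)" "l (corner 0) \<noteq> l (corner 2)" "l (corner 1) \<noteq> l (corner 2)"
      using inj_onD[OF l(4)] by blast+
  qed
  have \<pi>_inj: "inj_on \<pi> {..<3}"
  proof -
    \<comment> \<open>Three distinct labels below 3 exhaust \<open>{..<3}\<close>, so injectivity on
      them suffices.\<close>
    have "{l (corner 0), l (corner 1), l (corner 2)} = {..<3}"
      by (rule card_subset_eq) (use l(1) cor in simp_all)
    moreover have "inj_on \<pi> {l (corner 0), l (corner 1), l (corner 2)}"
      using cor by (simp add: \<pi>_def)
    ultimately show ?thesis by simp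
  qed
  have \<pi>_corner: "\<pi> (l (corner i)) = Suc i" if "i < 3" for i
    using that cor unfolding less_3_iff \<pi>_def by auto
  define L where "L x = \<pi> (l (\<phi> x))" for x
  have rainbow_iff: "rainbow L \<tau> \<longleftrightarrow> \<tau> = \<sigma>" if \<tau>: "\<tau> \<in> complex_facets 2 K" for \<tau>
  proof -
    obtain B where B: "\<not> affine_dependent B" "card B = 3" "\<tau> = convex hull B" "simplex_vertices \<tau> = B"
      "aff_dim \<tau> = 2" using facet[OF \<tau>] by blast
    have \<tau>K: "\<tau> \<in> K" using \<tau> unfolding complex_facets_def by blast
    obtain x y z where xyz: "B = {x, y, z}" "x \<noteq> y" "y \<noteq> z" "x \<noteq> z"
      using B(2)[unfolded card_3_iff] by (elim exE conjE) (rule that)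
    have edge: "(\<phi> a, \<phi> b) \<in> E" if "a \<in> B" "b \<in> B" "a \<noteq> b" for a b
    proof -
      have "convex hull {a, b} face_of \<tau>"
        unfolding B(3) face_of_convex_hull_affine_independent[OF B(1)]
        by (rule exI[of _ "{a, b}"]) (use that in simp)
      then have "convex hull {a, b} \<in> K" by (rule K(2)[OF \<tau>K])
      then show ?thesis using that(3) unfolding E_def by blast
    qed
    have E: "(\<phi> x, \<phi> y) \<in> E" "(\<phi> y, \<phi> z) \<in> E" "(\<phi> z, \<phi> x) \<in> E"
      by (rule edge; use xyz in simp)+
    have im: "\<phi> ` B = {\<phi> x, \<phi> y, \<phi> z}" "\<phi> ` \<tau> = convex hull {\<phi> x, \<phi> y, \<phi> z}"
      unfolding B(3) hull xyz(1) by simp_all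
    have "B \<subseteq> ?D" using sub[OF \<tau>K] hull_subset[of B convex] unfolding B(3) by blast
    then have injB: "inj_on \<phi> B" using inj inj_on_subset by blast
    have "rainbow L \<tau> \<longleftrightarrow> inj_on (\<pi> \<circ> (l \<circ> \<phi>)) B"
      unfolding rainbow_def B(4) L_def comp_def ..
    also have "\<dots> \<longleftrightarrow> inj_on (l \<circ> \<phi>) B"
      using comp_inj_on[of "l \<circ> \<phi>" B \<pi>] inj_on_imageI2[of \<pi> "l \<circ> \<phi>" B] inj_on_subset[OF \<pi>_inj] l(1)
      by (metis (no_types, lifting) comp_apply image_subsetI lessThan_iff)
    also have "\<dots> \<longleftrightarrow> inj_on l (\<phi> ` B)"
      using comp_inj_on_iff[OF injB] by blast
    also have "\<dots> \<longleftrightarrow> \<tau> = \<sigma>"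
    proof
      assume "inj_on l (\<phi> ` B)"
      then have "p \<in> \<phi> ` \<tau>" using l(2)[OF E] unfolding im by blast
      then show "\<tau> = \<sigma>" using p_avoids[OF \<tau>K] B(3,5) by auto
    next
      assume "\<tau> = \<sigma>"
      then show "inj_on l (\<phi> ` B)" using l(3)[OF E] p_int unfolding im(1) im(2)[symmetric] by blast
    qed
    finally show ?thesis .
  qed

  \<comment> \<open>The Sperner conditions\<close>
  have index: "\<exists>j<3. i = Suc j" if "i \<in> {1..2+1}" for i :: nat
    using that by (intro exI[of _ "i - 1"]) auto
  have L_v: "L (v i) = i" if "i \<in> {1..2+1}" for i
  proof -
    obtain j where "i = Suc j" "j < 3" using index \<open>i \<in> {1..2+1}\<close> by blast
    then show ?thesis unfolding L_def using \<phi>v \<pi>_corner by simp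
  qed
  have L_range: "L x \<in> {1..2+1}" for x unfolding L_def \<pi>_def by auto
  have "\<exists>w \<in> simplex_vertices F. L x = L w"
    if F: "F face_of ?D" and x: "x \<in> complex_vertices K \<inter> F" for F x
  proof (rule ccontr)
    assume neq: "\<not> (\<exists>w \<in> simplex_vertices F. L x = L w)"
    have ind: "\<not> affine_dependent (v ` {1..2+1})" using assms(1) unfolding spans_simplex_def by blast
    obtain c where c: "c \<subseteq> v ` {1..2+1}" "F = convex hull c"
      using F unfolding std_simplex_def face_of_convex_hull_affine_independent[OF ind] by blast
    have "\<not> affine_dependent c" using ind c(1) affine_dependent_subset by blast
    then have vc: "simplex_vertices F = c"
      using extreme_point_of_convex_hull_affine_independent unfolding simplex_vertices_def c(2) by blast
    obtain i where i: "L x = Suc i" "i < 3" using index[OF L_range] by blast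
    \<comment> \<open>Faces of every dimension reduce to sides: if no vertex of \<open>F\<close> has
      the label \<open>Suc i\<close>, then \<open>F\<close> lies in the side opposite to
      \<open>corner i\<close>, whose vertices never receive that label.\<close>
    have "\<phi> ` c \<subseteq> {z. bary i z \<le> 0}"
    proof
      fix z assume "z \<in> \<phi> ` c"
      then obtain k where k: "k \<in> {1..2+1}" "z = \<phi> (v k)" "v k \<in> c" using c(1) by blast
      then obtain j where j: "k = Suc j" "j < 3" using index by blast
      have "j \<noteq> i" using neq L_v[OF k(1)] k(3) i(1) j(1) unfolding vc by metis
      then show "z \<in> {z. bary i z \<le> 0}"
        using k(2) \<phi>v[OF j(2)] j i(2) by (simp add: bary_corner)
    qed
    then have "convex hull (\<phi> ` c) \<subseteq> {z. bary i z \<le> 0}"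
      by (intro hull_minimal convex_bary_nonpos)
    then have "bary i (\<phi> x) \<le> 0" using x unfolding c(2) hull[symmetric] by blast
    moreover have xV: "\<phi> x \<in> V" using x unfolding V_def by blast
    ultimately have "bary i (\<phi> x) = 0" using nonneg[OF i(2) xV] by simp
    then obtain j where "j < 3" "j \<noteq> i" "l (\<phi> x) = l (corner j)" using l(5)[OF i(2) xV] by blast
    then show False using i(1) \<pi>_corner unfolding L_def by simp
  qed
  then have "sperner_labelling 2 v K L"
    unfolding sperner_labelling_def using L_v L_range by blast
  then show ?thesis using rainbow_iff assms(3) by blast
qed

end
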